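(* Let $\mathcal A$ be a basic algebra and suppose that the monomial ordering on $E$ is a negative degree ordering. Let $d$ be a positive integer, let $\tau$ be the greatest monomial of $E$ such that $\deg(\tau)=d-1$, and let $\tau'$ be the greatest monomial of $E$ such that $\deg(\tau')=d$. Let $G$ be an interreduced signed standard basis of $M$. Then $$\{[f] : f\in B_\tau(M,G)\setminus B_{\tau'}(M,G)\}$$ is a $K$-vector space basis of the $d$-th Loewy layer $\mathrm{Rad}^{d-1}(M)/\mathrm{Rad}^d(M)$ of $M$, where $[f]$ denotes the class of $f$ in $\mathrm{Rad}^{d-1}(M)/\mathrm{Rad}^d(M)$.
   Context: Algebra. Let $K$ be a field and $\mathcal P$ the path algebra over $K$ of a finite quiver $Q$. Its monomials $\mathrm{Mon}(\mathcal P)$ are the directed paths in $Q$ (including the trivial path $1_v$ at each vertex $v$); they form a $K$-basis of $\mathcal P$; $b\cdot c$ is the concatenation if $b$ ends where $c$ starts, and $0$ otherwise; $\deg$ is path length. A monomial ordering on $\mathcal P$ is a total ordering $>$ on $\mathrm{Mon}(\mathcal P)$ such that $b_1>b_2$ implies $b_1b>b_2b$ whenever both products are non-zero, and $b'b_1>b'b_2$ whenever both products are non-zero; fix one. The leading monomial $\mathrm{lm}(p)$ of $p\neq0$ is the greatest monomial occurring in $p$. Let $\psi:\mathcal P\to\mathcal A$ be the quotient map onto a quotient algebra. $\mathcal A$ is a basic algebra: it is finite-dimensional over $K$, every element of $\ker\psi$ is a linear combination of paths of length at least $2$, and (as the paper states) $\mathrm{Rad}(\mathcal A)$ is the ideal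 generated by the images of the arrows. Let $\mathrm{stdMon}$ be the set of monomials of $\mathcal P$ that are not leading monomials of elements of $\ker\psi$. Standing fact: $\psi$ is injective on $\mathrm{stdMon}$ and $\mathcal B_>(\mathcal A)=\psi(\mathrm{stdMon})$ is a $K$-basis of $\mathcal A$; its elements are the monomials of $\mathcal A$. For $b\in\mathcal B_>(\mathcal A)$, $\lambda(b)$ is the unique element of $\mathrm{stdMon}$ with $\psi(\lambda(b))=b$; $b>b'$ iff $\lambda(b)>\lambda(b')$. For $b,c\in\mathcal B_>(\mathcal A)$, $c$ is a small cofactor of $b$ if $\lambda(b)\lambda(c)\in\mathrm{stdMon}$. Modules. $F=\mathcal A^r$ is the free right-$\mathcal A$ module with free generators $\mathfrak v_1,\dots,\mathfrak v_r$ and monomials $\mathfrak v_i\cdot b$ ($b\in\mathcal B_>(\mathcal A)$), with a fixed compatible total ordering on its monomials: $b_1>b_2$ implies $\mathfrak v_ib_1>\mathfrak v_ib_2$; and $\mathfrak v_ib_1>\mathfrak v_jb_2$ implies $\mathfrak v_ib_1b>\mathfrak v_j\mathrm{lm}(b_2b)$ or $b_2b=0$, whenever $b$ is a small cofactor of $b_1$. $\mathrm{lm}$ is defined for non-zero elements of $F$. Small cofactors of $\mathfrak v_ib$ are those of $b$. Signatures. $M\subseteq F$ is a submodule with a fixed finite ordered generating set $\hat g_1,\dots,\hat g_m$. $E=\mathcal P^m$ is the free right-$\mathcal P$ module with free generators $\mathfrak e_1,\dots,\mathfrak e_m$, with monomials $\mathrm{Mon}(E)=\{\mathfrak e_i b: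 b\in\mathrm{Mon}(\mathcal P)\}$, $\deg(\mathfrak e_ib)=\deg b$, and a fixed compatible total ordering: $b_1>b_2$ implies $\mathfrak e_ib_1>\mathfrak e_ib_2$; and $\mathfrak e_ib_1>\mathfrak e_jb_2$ implies $\mathfrak e_ib_1b>\mathfrak e_jb_2b$ whenever both products are non-zero. It is a negative degree ordering if $\deg(s)>\deg(t)$ implies $s<t$ for $s,t\in\mathrm{Mon}(E)$. $ev:E\to M$ is the $K$-linear map with $ev(\mathfrak e_i c)=\hat g_i\psi(c)$. A signed element of $M$ is a pair $f=(f_u,s)$, $f_u\in M$, $s\in\mathrm{Mon}(E)$, such that some $\tilde f\in E$ has $\mathrm{lm}(\tilde f)=s$ and $ev(\tilde f)=f_u$; write $\mathrm{poly}(f)=f_u$, $\sigma(f)=s$, $\mathrm{lm}(f)=\mathrm{lm}(f_u)$. It is a signed element of $M\setminus\{0\}$ if $f_u\ne0$; signed subsets are sets of signed elements. Every comparison or equality of $\sigma(g)\cdot\lambda(c)$ with a monomial of $E$ presupposes $\sigma(g)\cdot\lambda(c)\neq0$. For $0\ne f\in F$, $s\in\mathrm{Mon}(E)$ and a signed subset $G$ of $M\setminus\{0\}$: $f$ is $s$-reducible (resp. weakly $s$-reducible) with respect to $G$ if there are $g\in G$ and a small cofactor $c$ of $\mathrm{lm}(g)$ with $\mathrm{lm}(g)c=\mathrm{lm}(f)$ and $\sigma(g)\lambda(c)<s$ (resp. $\le s$); with respect to $M\setminus\{0\}$ means with respect to $\{g\}$ for some signed element $g$ of $M\setminus\{0\}$.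 $f\in F$ is $s$-irreducible if $f=0$ or $f$ is not $s$-reducible. A finite signed subset $G$ of $M\setminus\{0\}$ is interreduced if for every $g\in G$, $\mathrm{poly}(g)$ is $\sigma(g)$-irreducible with respect to $G$, and there are no distinct $g,g'\in G$ with a small cofactor $c$ of $\mathrm{lm}(g')$ such that $\mathrm{lm}(g')c=\mathrm{lm}(g)$ and $\sigma(g')\lambda(c)=\sigma(g)$. It is a signed standard basis of $M$ if for every signed element $f$ of $M\setminus\{0\}$ such that $\mathrm{poly}(f)$ is $\sigma(f)$-irreducible with respect to $M\setminus\{0\}$, $\mathrm{poly}(f)$ is weakly $\sigma(f)$-reducible with respect to $G$. For $\tau\in\mathrm{Mon}(E)$, $B_\tau(M,G)$ is the set of all $\mathrm{poly}(g)\cdot c$ with $g\in G$ and $c$ a small cofactor of $\mathrm{lm}(g)$ such that $\sigma(g)\lambda(c)\le\tau$ and $\mathrm{poly}(g)\cdot c$ is $\sigma(g)\lambda(c)$-irreducible with respect to $G$. Radicals. $\mathrm{Rad}(M)$ is the intersection of all maximal submodules of $M$; $\mathrm{Rad}^0(M)=M$, $\mathrm{Rad}^d(M)=\mathrm{Rad}(\mathrm{Rad}^{d-1}(M))$. *)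

theory Defs
  imports
    "Graph_Theory.Arc_Walk"
    "HOL-Library.Poly_Mapping"
    "HOL-Library.Function_Algebras"
    "HOL-Library.Set_Algebras"
begin

section \<open>Radicals of right modules\<close>

text \<open>
  A right module is a set \<open>M\<close> in an additive group with an action \<open>act x a\<close> of a unital
  ring.  The library's modules are left modules over commutative rings only.
\<close>

definition right_submodule ::
  "('m::ab_group_add \<Rightarrow> 'a \<Rightarrow> 'm) \<Rightarrow> 'm set \<Rightarrow> 'm set \<Rightarrow> bool" where
  "right_submodule act N M \<longleftrightarrow> N \<subseteq> M \<and> 0 \<in> N \<and> (\<forall>x\<in>N. \<forall>y\<in>N. x + y \<in> N) \<and>
     (\<forall>x\<in>N. - x \<in> N) \<and> (\<forall>x\<in>N. \<forall>a. act x a \<in> N)"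

definition maximal_submodule ::
  "('m::ab_group_add \<Rightarrow> 'a \<Rightarrow> 'm) \<Rightarrow> 'm set \<Rightarrow> 'm set \<Rightarrow> bool" where
  "maximal_submodule act N M \<longleftrightarrow> right_submodule act N M \<and> N \<noteq> M \<and>
     (\<forall>N'. right_submodule act N' M \<and> N \<subseteq> N' \<longrightarrow> N' = N \<or> N' = M)"

text \<open>The empty intersection is \<open>M\<close> itself, so that the zero module has radical zero.\<close>

definition Rad :: "('m::ab_group_add \<Rightarrow> 'a \<Rightarrow> 'm) \<Rightarrow> 'm set \<Rightarrow> 'm set" where
  "Rad act M = M \<inter> \<Inter> {N. maximal_submodule act N M}"

definition two_sided_ideal :: "'a::ring set \<Rightarrow> bool" where
  "two_sided_ideal I \<longleftrightarrow> 0 \<in> I \<and> (\<forall>x\<in>I. \<forall>y\<in>I. x + y \<in> I) \<and> (\<forall>x\<in>I. - x \<in> I) \<and>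
     (\<forall>x\<in>I. \<forall>a. a * x \<in> I \<and> x * a \<in> I)"

definition ideal_generated :: "'a::ring set \<Rightarrow> 'a set" where
  "ideal_generated X = \<Inter> {I. two_sided_ideal I \<and> X \<subseteq> I}"


section \<open>Bases of quotient vector spaces\<close>

text \<open>
  The quotient \<open>V/W\<close> is the set of cosets \<open>x +o W\<close> with \<open>x \<in> V\<close>; its zero is \<open>W\<close>.
  Cosets are added elementwise.  Adding \<open>W\<close> in a linear combination makes the result a coset
  also if the sum is empty or some coefficient is zero (the elementwise multiple of a coset by
  zero is only \<open>{0}\<close>).
\<close>

definition quotient_space :: "'m::ab_group_add set \<Rightarrow> 'm set \<Rightarrow> 'm set set" where
  "quotient_space V W = (\<lambda>x. x +o W) ` V"

definition quotient_lincomb ::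
  "('k \<Rightarrow> 'm \<Rightarrow> 'm) \<Rightarrow> 'm::ab_group_add set \<Rightarrow> 'm set set \<Rightarrow> ('m set \<Rightarrow> 'k) \<Rightarrow> 'm set" where
  "quotient_lincomb scl W T a = W + (\<Sum>C\<in>T. scl (a C) ` C)"

definition is_quotient_basis ::
  "('k::field \<Rightarrow> 'm \<Rightarrow> 'm) \<Rightarrow> 'm::ab_group_add set \<Rightarrow> 'm set \<Rightarrow> 'm set set \<Rightarrow> bool" where
  "is_quotient_basis scl V W B \<longleftrightarrow>
     B \<subseteq> quotient_space V W \<and>
     (\<forall>T a. finite T \<and> T \<subseteq> B \<and> quotient_lincomb scl W T a = W \<longrightarrow> (\<forall>C\<in>T. a C = 0)) \<and>
     (\<forall>C\<in>quotient_space V W. \<exists>T a. finite T \<and> T \<subseteq> B \<and> C = quotient_lincomb scl W T a)"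


section \<open>Orderings\<close>

text \<open>All orderings are given by their strict part, with \<open>lt x y\<close> for \<open>x < y\<close>.\<close>

definition total_ordering_on :: "'b set \<Rightarrow> ('b \<Rightarrow> 'b \<Rightarrow> bool) \<Rightarrow> bool" where
  "total_ordering_on X lt \<longleftrightarrow> irreflp_on X lt \<and> transp_on X lt \<and> totalp_on X lt"

definition is_greatest :: "('b \<Rightarrow> 'b \<Rightarrow> bool) \<Rightarrow> 'b set \<Rightarrow> 'b \<Rightarrow> bool" where
  "is_greatest lt X x \<longleftrightarrow> x \<in> X \<and> (\<forall>y\<in>X. y = x \<or> lt y x)"

definition greatest :: "('b \<Rightarrow> 'b \<Rightarrow> bool) \<Rightarrow> 'b set \<Rightarrow> 'b" where
  "greatest lt X = (THE x. is_greatest lt X x)"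


section \<open>Path algebras\<close>

text \<open>
  A path is its start vertex together with its list of arrows, so \<open>(v, [])\<close> is the trivial
  path at \<open>v\<close>.
\<close>

type_synonym ('v, 'e) path = "'v \<times> 'e list"

definition paths :: "('v, 'e) pre_digraph \<Rightarrow> ('v, 'e) path set" where
  "paths Q = {(u, p) | u p. \<exists>v. pre_digraph.awalk Q u p v}"

definition path_end :: "('v, 'e) pre_digraph \<Rightarrow> ('v, 'e) path \<Rightarrow> 'v" where
  "path_end Q b = last (pre_digraph.awalk_verts Q (fst b) (snd b))"

definition path_deg :: "('v, 'e) path \<Rightarrow> nat" where
  "path_deg b = length (snd b)"

text \<open>\<open>composable Q b c\<close> says that the product of the paths \<open>b\<close> and \<open>c\<close> is not zero; in this
  case the product is \<open>path_concat b c\<close>.\<close>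

definition composable :: "('v, 'e) pre_digraph \<Rightarrow> ('v, 'e) path \<Rightarrow> ('v, 'e) path \<Rightarrow> bool" where
  "composable Q b c \<longleftrightarrow> path_end Q b = fst c"

definition path_concat :: "('v, 'e) path \<Rightarrow> ('v, 'e) path \<Rightarrow> ('v, 'e) path" where
  "path_concat b c = (fst b, snd b @ snd c)"

definition path_algebra :: "('v, 'e) pre_digraph \<Rightarrow> (('v, 'e) path \<Rightarrow>\<^sub>0 'k::field) set" where
  "path_algebra Q = {p. Poly_Mapping.keys p \<subseteq> paths Q}"

definition pa_mult :: "('v, 'e) pre_digraph \<Rightarrow> (('v, 'e) path \<Rightarrow>\<^sub>0 'k::field) \<Rightarrow>
    (('v, 'e) path \<Rightarrow>\<^sub>0 'k) \<Rightarrow> (('v, 'e) path \<Rightarrow>\<^sub>0 'k)" where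
  "pa_mult Q p q = (\<Sum>b\<in>Poly_Mapping.keys p. \<Sum>c\<in>Poly_Mapping.keys q.
     if composable Q b c
     then Poly_Mapping.single (path_concat b c) (Poly_Mapping.lookup p b * Poly_Mapping.lookup q c)
     else 0)"

definition pa_one :: "('v, 'e) pre_digraph \<Rightarrow> (('v, 'e) path \<Rightarrow>\<^sub>0 'k::field)" where
  "pa_one Q = (\<Sum>v\<in>verts Q. Poly_Mapping.single (v, []) 1)"

definition pa_scale ::
  "'k::field \<Rightarrow> (('v, 'e) path \<Rightarrow>\<^sub>0 'k) \<Rightarrow> (('v, 'e) path \<Rightarrow>\<^sub>0 'k)" where
  "pa_scale k p = Poly_Mapping.map ((*) k) p"


section \<open>Data\<close>

text \<open>
  The data fixed throughout: the quiver \<open>Q\<close>; scalar multiplication on the quotient algebra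
  (whose elements form the type \<open>'a\<close>); the quotient map \<open>psi\<close>; the ordering on the paths; the
  rank \<open>r\<close> of the free module \<open>F\<close> and the ordering on its monomials; the submodule \<open>M\<close> with its
  list of generators; the ordering on the monomials of \<open>E\<close>.

  Generators of free modules are indexed from \<open>0\<close>.  Elements of \<open>F\<close> and \<open>E\<close> are coordinate
  functions that vanish beyond the rank.  A monomial of \<open>F\<close> or \<open>E\<close> is written as the pair of
  the index of the free generator and a monomial of the algebra.
\<close>

record (overloaded) ('v, 'e, 'k, 'a) sig_data =
  quiver :: "('v, 'e) pre_digraph"
  scaleA :: "'k \<Rightarrow> 'a \<Rightarrow> 'a"
  psi :: "(('v, 'e) path \<Rightarrow>\<^sub>0 'k) \<Rightarrow> 'a"
  ltP :: "('v, 'e) path \<Rightarrow> ('v, 'e) path \<Rightarrow> bool"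
  rankF :: nat
  ltF :: "nat \<times> 'a \<Rightarrow> nat \<times> 'a \<Rightarrow> bool"
  modM :: "(nat \<Rightarrow> 'a) set"
  gens :: "(nat \<Rightarrow> 'a) list"
  ltE :: "nat \<times> ('v, 'e) path \<Rightarrow> nat \<times> ('v, 'e) path \<Rightarrow> bool"


section \<open>The quotient algebra and its monomials\<close>

definition monP :: "('v, 'e, 'k::field, 'a) sig_data \<Rightarrow> ('v, 'e) path set" where
  "monP S = paths (quiver S)"

definition monomial_ordering :: "('v, 'e, 'k::field, 'a) sig_data \<Rightarrow> bool" where
  "monomial_ordering S \<longleftrightarrow> total_ordering_on (monP S) (ltP S) \<and>
     (\<forall>b\<^sub>1\<in>monP S. \<forall>b\<^sub>2\<in>monP S. \<forall>b\<in>monP S. ltP S b\<^sub>2 b\<^sub>1 \<longrightarrow>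
        (composable (quiver S) b\<^sub>1 b \<and> composable (quiver S) b\<^sub>2 b \<longrightarrow>
           ltP S (path_concat b\<^sub>2 b) (path_concat b\<^sub>1 b)) \<and>
        (composable (quiver S) b b\<^sub>1 \<and> composable (quiver S) b b\<^sub>2 \<longrightarrow>
           ltP S (path_concat b b\<^sub>2) (path_concat b b\<^sub>1)))"

definition quotient_algebra ::
  "('v, 'e, 'k::field, 'a::{ring, monoid_mult}) sig_data \<Rightarrow> bool" where
  "quotient_algebra S \<longleftrightarrow>
     vector_space (scaleA S) \<and>
     (\<forall>p\<in>path_algebra (quiver S). \<forall>q\<in>path_algebra (quiver S).
        psi S (p + q) = psi S p + psi S q \<and>
        psi S (pa_mult (quiver S) p q) = psi S p * psi S q) \<and>
     (\<forall>k. \<forall>p\<in>path_algebra (quiver S). psi S (pa_scale k p) = scaleA S k (psi S p)) \<and>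
     psi S (pa_one (quiver S)) = 1 \<and>
     psi S ` path_algebra (quiver S) = UNIV"

definition ker_psi :: "('v, 'e, 'k::field, 'a::zero) sig_data \<Rightarrow> (('v, 'e) path \<Rightarrow>\<^sub>0 'k) set" where
  "ker_psi S = {p \<in> path_algebra (quiver S). psi S p = 0}"

definition psi_mon :: "('v, 'e, 'k::field, 'a) sig_data \<Rightarrow> ('v, 'e) path \<Rightarrow> 'a" where
  "psi_mon S b = psi S (Poly_Mapping.single b 1)"

definition basic_algebra :: "('v, 'e, 'k::field, 'a::{ring, monoid_mult}) sig_data \<Rightarrow> bool" where
  "basic_algebra S \<longleftrightarrow>
     (\<exists>B. finite_dimensional_vector_space (scaleA S) B) \<and>
     (\<forall>p\<in>ker_psi S. \<forall>b\<in>Poly_Mapping.keys p. 2 \<le> path_deg b) \<and>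
     Rad (*) (UNIV :: 'a set) =
       ideal_generated ((\<lambda>e. psi_mon S (tail (quiver S) e, [e])) ` arcs (quiver S))"

definition lmP :: "('v, 'e, 'k::field, 'a) sig_data \<Rightarrow> (('v, 'e) path \<Rightarrow>\<^sub>0 'k) \<Rightarrow> ('v, 'e) path" where
  "lmP S p = greatest (ltP S) (Poly_Mapping.keys p)"

definition stdMon :: "('v, 'e, 'k::field, 'a::zero) sig_data \<Rightarrow> ('v, 'e) path set" where
  "stdMon S = monP S - {lmP S p | p. p \<in> ker_psi S \<and> p \<noteq> 0}"

definition monA :: "('v, 'e, 'k::field, 'a::zero) sig_data \<Rightarrow> 'a set" where
  "monA S = psi_mon S ` stdMon S"

definition lam :: "('v, 'e, 'k::field, 'a::zero) sig_data \<Rightarrow> 'a \<Rightarrow> ('v, 'e) path" where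
  "lam S b = (THE p. p \<in> stdMon S \<and> psi_mon S p = b)"

definition ltA :: "('v, 'e, 'k::field, 'a::zero) sig_data \<Rightarrow> 'a \<Rightarrow> 'a \<Rightarrow> bool" where
  "ltA S b b' \<longleftrightarrow> ltP S (lam S b) (lam S b')"

definition coeffA :: "('v, 'e, 'k::field, 'a::ring) sig_data \<Rightarrow> 'a \<Rightarrow> 'a \<Rightarrow> 'k" where
  "coeffA S x b = module.representation (scaleA S) (monA S) x b"

definition lmA :: "('v, 'e, 'k::field, 'a::ring) sig_data \<Rightarrow> 'a \<Rightarrow> 'a" where
  "lmA S x = greatest (ltA S) {b \<in> monA S. coeffA S x b \<noteq> 0}"

definition small_cofactor :: "('v, 'e, 'k::field, 'a::zero) sig_data \<Rightarrow> 'a \<Rightarrow> 'a \<Rightarrow> bool" where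
  "small_cofactor S b c \<longleftrightarrow> b \<in> monA S \<and> c \<in> monA S \<and>
     composable (quiver S) (lam S b) (lam S c) \<and> path_concat (lam S b) (lam S c) \<in> stdMon S"


section \<open>The free module \<open>F\<close> and the submodule \<open>M\<close>\<close>

definition modF :: "('v, 'e, 'k, 'a::zero) sig_data \<Rightarrow> (nat \<Rightarrow> 'a) set" where
  "modF S = {f. \<forall>i\<ge>rankF S. f i = 0}"

definition act :: "(nat \<Rightarrow> 'a::times) \<Rightarrow> 'a \<Rightarrow> nat \<Rightarrow> 'a" where
  "act f a = (\<lambda>i. f i * a)"

definition scaleF :: "('v, 'e, 'k, 'a) sig_data \<Rightarrow> 'k \<Rightarrow> (nat \<Rightarrow> 'a) \<Rightarrow> nat \<Rightarrow> 'a" where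
  "scaleF S k f = (\<lambda>i. scaleA S k (f i))"

definition monF :: "('v, 'e, 'k::field, 'a::zero) sig_data \<Rightarrow> (nat \<times> 'a) set" where
  "monF S = {..<rankF S} \<times> monA S"

definition compatible_ordering_F :: "('v, 'e, 'k::field, 'a::ring) sig_data \<Rightarrow> bool" where
  "compatible_ordering_F S \<longleftrightarrow> total_ordering_on (monF S) (ltF S) \<and>
     (\<forall>i<rankF S. \<forall>b\<^sub>1\<in>monA S. \<forall>b\<^sub>2\<in>monA S. ltA S b\<^sub>2 b\<^sub>1 \<longrightarrow> ltF S (i, b\<^sub>2) (i, b\<^sub>1)) \<and>
     (\<forall>i<rankF S. \<forall>j<rankF S. \<forall>b\<^sub>1\<in>monA S. \<forall>b\<^sub>2\<in>monA S. \<forall>b.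
        ltF S (j, b\<^sub>2) (i, b\<^sub>1) \<and> small_cofactor S b\<^sub>1 b \<longrightarrow>
          ltF S (j, lmA S (b\<^sub>2 * b)) (i, b\<^sub>1 * b) \<or> b\<^sub>2 * b = 0)"

definition lmF :: "('v, 'e, 'k::field, 'a::ring) sig_data \<Rightarrow> (nat \<Rightarrow> 'a) \<Rightarrow> nat \<times> 'a" where
  "lmF S f = greatest (ltF S) {(i, b). (i, b) \<in> monF S \<and> coeffA S (f i) b \<noteq> 0}"

definition generates_M :: "('v, 'e, 'k, 'a::ring) sig_data \<Rightarrow> bool" where
  "generates_M S \<longleftrightarrow> right_submodule act (modM S) (modF S) \<and>
     modM S = \<Inter> {N. right_submodule act N (modF S) \<and> set (gens S) \<subseteq> N}"


section \<open>The free module \<open>E\<close> and signatures\<close>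

definition modE ::
  "('v, 'e, 'k::field, 'a) sig_data \<Rightarrow> (nat \<Rightarrow> (('v, 'e) path \<Rightarrow>\<^sub>0 'k)) set" where
  "modE S = {x. (\<forall>i<length (gens S). x i \<in> path_algebra (quiver S)) \<and>
                (\<forall>i\<ge>length (gens S). x i = 0)}"

definition monE :: "('v, 'e, 'k::field, 'a) sig_data \<Rightarrow> (nat \<times> ('v, 'e) path) set" where
  "monE S = {..<length (gens S)} \<times> monP S"

definition degE :: "nat \<times> ('v, 'e) path \<Rightarrow> nat" where
  "degE s = path_deg (snd s)"

definition composableE ::
  "('v, 'e, 'k, 'a) sig_data \<Rightarrow> nat \<times> ('v, 'e) path \<Rightarrow> ('v, 'e) path \<Rightarrow> bool" where
  "composableE S s c \<longleftrightarrow> composable (quiver S) (snd s) c"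

definition concatE :: "nat \<times> ('v, 'e) path \<Rightarrow> ('v, 'e) path \<Rightarrow> nat \<times> ('v, 'e) path" where
  "concatE s c = (fst s, path_concat (snd s) c)"

definition compatible_ordering_E :: "('v, 'e, 'k::field, 'a) sig_data \<Rightarrow> bool" where
  "compatible_ordering_E S \<longleftrightarrow> total_ordering_on (monE S) (ltE S) \<and>
     (\<forall>i<length (gens S). \<forall>b\<^sub>1\<in>monP S. \<forall>b\<^sub>2\<in>monP S.
        ltP S b\<^sub>2 b\<^sub>1 \<longrightarrow> ltE S (i, b\<^sub>2) (i, b\<^sub>1)) \<and>
     (\<forall>s\<in>monE S. \<forall>t\<in>monE S. \<forall>b\<in>monP S.
        ltE S t s \<and> composableE S s b \<and> composableE S t b \<longrightarrow>
          ltE S (concatE t b) (concatE s b))"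

definition negative_degree_ordering :: "('v, 'e, 'k::field, 'a) sig_data \<Rightarrow> bool" where
  "negative_degree_ordering S \<longleftrightarrow> (\<forall>s\<in>monE S. \<forall>t\<in>monE S. degE t < degE s \<longrightarrow> ltE S s t)"

definition lmE :: "('v, 'e, 'k::field, 'a) sig_data \<Rightarrow> (nat \<Rightarrow> (('v, 'e) path \<Rightarrow>\<^sub>0 'k)) \<Rightarrow>
    nat \<times> ('v, 'e) path" where
  "lmE S x = greatest (ltE S) {(i, b). (i, b) \<in> monE S \<and> Poly_Mapping.lookup (x i) b \<noteq> 0}"

definition ev ::
  "('v, 'e, 'k::field, 'a::ring) sig_data \<Rightarrow> (nat \<Rightarrow> (('v, 'e) path \<Rightarrow>\<^sub>0 'k)) \<Rightarrow> nat \<Rightarrow> 'a" where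
  "ev S x = (\<Sum>i<length (gens S). act (gens S ! i) (psi S (x i)))"

type_synonym ('v, 'e, 'a) signed = "(nat \<Rightarrow> 'a) \<times> (nat \<times> ('v, 'e) path)"

abbreviation poly_part :: "('v, 'e, 'a) signed \<Rightarrow> nat \<Rightarrow> 'a" where
  "poly_part g \<equiv> fst g"

abbreviation sig :: "('v, 'e, 'a) signed \<Rightarrow> nat \<times> ('v, 'e) path" where
  "sig g \<equiv> snd g"

definition signed_element ::
  "('v, 'e, 'k::field, 'a::ring) sig_data \<Rightarrow> ('v, 'e, 'a) signed \<Rightarrow> bool" where
  "signed_element S g \<longleftrightarrow> poly_part g \<in> modM S \<and> sig g \<in> monE S \<and>
     (\<exists>x\<in>modE S. x \<noteq> 0 \<and> lmE S x = sig g \<and> ev S x = poly_part g)"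

definition signed_nonzero ::
  "('v, 'e, 'k::field, 'a::ring) sig_data \<Rightarrow> ('v, 'e, 'a) signed set" where
  "signed_nonzero S = {g. signed_element S g \<and> poly_part g \<noteq> 0}"


section \<open>Reduction and signed standard bases\<close>

abbreviation leE :: "('v, 'e, 'k, 'a) sig_data \<Rightarrow>
    nat \<times> ('v, 'e) path \<Rightarrow> nat \<times> ('v, 'e) path \<Rightarrow> bool" where
  "leE S s t \<equiv> ltE S s t \<or> s = t"

definition small_cofactor_F ::
  "('v, 'e, 'k::field, 'a::zero) sig_data \<Rightarrow> nat \<times> 'a \<Rightarrow> 'a \<Rightarrow> bool" where
  "small_cofactor_F S t c \<longleftrightarrow> small_cofactor S (snd t) c"

definition mult_monF :: "nat \<times> 'a::times \<Rightarrow> 'a \<Rightarrow> nat \<times> 'a" where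
  "mult_monF t c = (fst t, snd t * c)"

definition s_reducible :: "('v, 'e, 'k::field, 'a::ring) sig_data \<Rightarrow> ('v, 'e, 'a) signed set \<Rightarrow>
    nat \<times> ('v, 'e) path \<Rightarrow> (nat \<Rightarrow> 'a) \<Rightarrow> bool" where
  "s_reducible S G s f \<longleftrightarrow> f \<noteq> 0 \<and>
     (\<exists>g\<in>G. \<exists>c. small_cofactor_F S (lmF S (poly_part g)) c \<and>
        mult_monF (lmF S (poly_part g)) c = lmF S f \<and>
        composableE S (sig g) (lam S c) \<and> ltE S (concatE (sig g) (lam S c)) s)"

definition weakly_s_reducible ::
  "('v, 'e, 'k::field, 'a::ring) sig_data \<Rightarrow> ('v, 'e, 'a) signed set \<Rightarrow>
    nat \<times> ('v, 'e) path \<Rightarrow> (nat \<Rightarrow> 'a) \<Rightarrow> bool" where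
  "weakly_s_reducible S G s f \<longleftrightarrow> f \<noteq> 0 \<and>
     (\<exists>g\<in>G. \<exists>c. small_cofactor_F S (lmF S (poly_part g)) c \<and>
        mult_monF (lmF S (poly_part g)) c = lmF S f \<and>
        composableE S (sig g) (lam S c) \<and> leE S (concatE (sig g) (lam S c)) s)"

definition s_irreducible :: "('v, 'e, 'k::field, 'a::ring) sig_data \<Rightarrow> ('v, 'e, 'a) signed set \<Rightarrow>
    nat \<times> ('v, 'e) path \<Rightarrow> (nat \<Rightarrow> 'a) \<Rightarrow> bool" where
  "s_irreducible S G s f \<longleftrightarrow> f = 0 \<or> \<not> s_reducible S G s f"

definition interreduced ::
  "('v, 'e, 'k::field, 'a::ring) sig_data \<Rightarrow> ('v, 'e, 'a) signed set \<Rightarrow> bool" where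
  "interreduced S G \<longleftrightarrow>
     (\<forall>g\<in>G. s_irreducible S G (sig g) (poly_part g)) \<and>
     \<not> (\<exists>g\<in>G. \<exists>g'\<in>G. g \<noteq> g' \<and>
          (\<exists>c. small_cofactor_F S (lmF S (poly_part g')) c \<and>
               mult_monF (lmF S (poly_part g')) c = lmF S (poly_part g) \<and>
               composableE S (sig g') (lam S c) \<and> concatE (sig g') (lam S c) = sig g))"

text \<open>Reducibility with respect to \<open>M \<setminus> {0}\<close> is reducibility with respect to the set of all
  its signed elements.\<close>

definition signed_standard_basis ::
  "('v, 'e, 'k::field, 'a::ring) sig_data \<Rightarrow> ('v, 'e, 'a) signed set \<Rightarrow> bool" where
  "signed_standard_basis S G \<longleftrightarrow> finite G \<and> G \<subseteq> signed_nonzero S \<and>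
     (\<forall>f\<in>signed_nonzero S. s_irreducible S (signed_nonzero S) (sig f) (poly_part f) \<longrightarrow>
        weakly_s_reducible S G (sig f) (poly_part f))"

definition Bset :: "('v, 'e, 'k::field, 'a::ring) sig_data \<Rightarrow> ('v, 'e, 'a) signed set \<Rightarrow>
    nat \<times> ('v, 'e) path \<Rightarrow> (nat \<Rightarrow> 'a) set" where
  "Bset S G \<tau> = {act (poly_part g) c | g c. g \<in> G \<and> small_cofactor_F S (lmF S (poly_part g)) c \<and>
     composableE S (sig g) (lam S c) \<and> leE S (concatE (sig g) (lam S c)) \<tau> \<and>
     s_irreducible S G (concatE (sig g) (lam S c)) (act (poly_part g) c)}"

end

theory Submission
  imports Defs
begin

text \<open>
  Let \<open>J\<close> be the radical of the algebra.  Since \<open>J\<close> is generated by the arrows, \<open>M J\<^sup>k\<close> is spanned by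
  the products of generators of \<open>M\<close> with paths of length at least \<open>k\<close>; it is denoted \<open>Mdeg k\<close>
  below.  The theorem is the combination of two descriptions of these submodules.

  Firstly, \<open>M J\<^sup>k\<close> is the \<open>k\<close>-th iterated radical of \<open>M\<close> (lemma \<open>Rad_Mdeg\<close>).  Every maximal submodule
  of a module \<open>N\<close> contains \<open>N J\<close>, because simple modules are killed by \<open>J\<close>.  Conversely, modulo \<open>J\<close> the
  algebra is spanned by the trivial paths, which are orthogonal idempotents with sum 1; so \<open>N/NJ\<close>
  is spanned by simultaneous eigenvectors and has radical zero.

  Secondly, if \<open>\<tau>\<close> is the greatest monomial of \<open>E\<close> of degree \<open>k\<close>, then \<open>B\<^sub>\<tau>(M,G)\<close> is a basis of \<open>M J\<^sup>k\<close>
  (lemma \<open>Bset_basis\<close>).  For a negative degree ordering the monomials \<open>s \<le> \<tau>\<close> are those of degree at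
  least \<open>k\<close>, so the non-zero elements of \<open>M J\<^sup>k\<close> are those that have a signature at most \<open>\<tau>\<close>.
  By Gaussian elimination it suffices to compare leading monomials: different elements of
  \<open>B\<^sub>\<tau>(M,G)\<close> have different leading monomials as \<open>G\<close> is interreduced, and each leading monomial of
  a non-zero element of \<open>M J\<^sup>k\<close> occurs as \<open>G\<close> is a signed standard basis.

  The bases for \<open>k = d - 1\<close> and \<open>k = d\<close> are nested, so their difference induces a basis of the
  quotient.  The orderings on paths and on the monomials of \<open>E\<close> may have infinite descending chains;
  termination rests on the nilpotency of \<open>J\<close> (lemma \<open>path_ideal_nilpotent\<close>), due to which long paths
  vanish in the algebra and only finitely many monomials and signatures matter.
\<close>

section \<open>Greatest elements\<close>

lemma total_ordering_on_irrefl: "total_ordering_on X lt \<Longrightarrow> x \<in> X \<Longrightarrow> \<not> lt x x"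
  by (auto simp: total_ordering_on_def irreflp_on_def)

lemma total_ordering_on_trans:
  "total_ordering_on X lt \<Longrightarrow> lt x y \<Longrightarrow> lt y z \<Longrightarrow> x \<in> X \<Longrightarrow> y \<in> X \<Longrightarrow> z \<in> X \<Longrightarrow> lt x z"
  unfolding total_ordering_on_def transp_on_def by blast

lemma total_ordering_on_total:
  "total_ordering_on X lt \<Longrightarrow> x \<in> X \<Longrightarrow> y \<in> X \<Longrightarrow> x = y \<or> lt x y \<or> lt y x"
  unfolding total_ordering_on_def totalp_on_def by blast

lemma greatest_eqI:
  assumes "total_ordering_on X lt" "A \<subseteq> X" "is_greatest lt A x"
  shows "greatest lt A = x"
  unfolding greatest_def
proof (rule the_equality[where P = "is_greatest lt A"])
  show "is_greatest lt A x" by fact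
next
  fix y assume y: "is_greatest lt A y"
  have "x \<in> X" "y \<in> X" "y = x \<or> lt y x" "x = y \<or> lt x y"
    using assms y by (auto simp: is_greatest_def)
  then show "y = x"
    using total_ordering_on_trans[OF assms(1)] total_ordering_on_irrefl[OF assms(1)] by blast
qed

lemma is_greatest_greatest:
  assumes X: "total_ordering_on X lt" "A \<subseteq> X" and A: "finite A" "A \<noteq> {}"
  shows "is_greatest lt A (greatest lt A)"
proof -
  have "\<exists>x. is_greatest lt A x"
    using A X(2)
  proof (induction A rule: finite_ne_induct)
    case (singleton x)
    then show ?case by (auto simp: is_greatest_def)
  next
    case (insert y A)
    then obtain x where x: "is_greatest lt A x" by auto
    then have "x \<in> A" by (simp add: is_greatest_def)
    with insert.prems consider "y = x" | "lt y x" | "lt x y"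
      using total_ordering_on_total[OF X(1), of x y] by auto
    then show ?case
    proof cases
      case 3
      have "lt z y" if "z \<in> A" for z
      proof -
        have "z \<in> X" "x \<in> X" "y \<in> X" "z = x \<or> lt z x"
          using that x insert.prems \<open>x \<in> A\<close> by (auto simp: is_greatest_def)
        then show ?thesis using 3 total_ordering_on_trans[OF X(1), of z x y] by auto
      qed
      then show ?thesis by (auto simp: is_greatest_def intro!: exI[of _ y])
    qed (use x in \<open>auto simp: is_greatest_def\<close>)
  qed
  then show ?thesis using greatest_eqI[OF X] by auto
qed

lemma total_ordering_on_converse:
  "total_ordering_on X lt \<Longrightarrow> total_ordering_on X (\<lambda>x y. lt y x)"
  unfolding total_ordering_on_def irreflp_on_def transp_on_def totalp_on_def by blast

section \<open>Leading monomials and bases of quotients\<close>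

definition leading :: "('x \<Rightarrow> 'x \<Rightarrow> bool) \<Rightarrow> 'x set \<Rightarrow> ('b \<Rightarrow> 'x \<Rightarrow> 'k::zero) \<Rightarrow> 'b \<Rightarrow> 'x" where
  "leading lt X coef f = greatest lt {x \<in> X. coef f x \<noteq> 0}"

context vector_space
begin

text \<open>
  Gaussian elimination.  Distinct leading monomials make \<open>B\<close> independent, because the largest one
  that occurs in a linear combination cannot cancel.  If every non-zero element of \<open>V\<close> shares its
  leading monomial with an element of \<open>B\<close>, then subtracting a multiple of that element lowers the
  leading monomial, and this ends after finitely many steps since \<open>X\<close> is finite.
\<close>

lemma leading_monomials_basis:
  fixes coef :: "'b \<Rightarrow> 'x \<Rightarrow> 'a"
  assumes X: "finite X" "total_ordering_on X lt"
    and coef: "\<And>u v x. coef (u + v) x = coef u x + coef v x"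
      "\<And>c v x. coef (scale c v) x = c * coef v x"
    and V: "subspace V" "\<And>f. f \<in> V \<Longrightarrow> (\<And>x. x \<in> X \<Longrightarrow> coef f x = 0) \<Longrightarrow> f = 0"
    and B: "B \<subseteq> V" "0 \<notin> B" "inj_on (leading lt X coef) B"
      "\<And>f. f \<in> V \<Longrightarrow> f \<noteq> 0 \<Longrightarrow> \<exists>b\<in>B. leading lt X coef b = leading lt X coef f"
  shows "independent B" "span B = V"
proof -
  let ?l = "leading lt X coef"
  have lead: "?l f \<in> X" "coef f (?l f) \<noteq> 0" 
    "\<And>x. x \<in> X \<Longrightarrow> coef f x \<noteq> 0 \<Longrightarrow> x = ?l f \<or> lt x (?l f)" if "f \<in> V" "f \<noteq> 0" for f
  proof -
    have "is_greatest lt {x \<in> X. coef f x \<noteq> 0} (?l f)"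
      unfolding leading_def using X V(2)[OF that(1)] that(2)
      by (intro is_greatest_greatest[OF X(2)]) auto
    then show "?l f \<in> X" "coef f (?l f) \<noteq> 0" 
    "\<And>x. x \<in> X \<Longrightarrow> coef f x \<noteq> 0 \<Longrightarrow> x = ?l f \<or> lt x (?l f)" by (auto simp: is_greatest_def)
  qed
  have irrefl: "\<not> lt x x" if "x \<in> X" for x
    using total_ordering_on_irrefl[OF X(2) that] .
  have trans: "lt x z" if "lt x y" "lt y z" "x \<in> X" "y \<in> X" "z \<in> X" for x y z
    using total_ordering_on_trans[OF X(2)] that by blast
  have coef0: "coef 0 x = 0" for x using coef(2)[of 0 0 x] by simp
  have coef_sum: "coef (\<Sum>v\<in>T. scale (u v) v) x = (\<Sum>v\<in>T. u v * coef v x)" if "finite T" for T u x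
    using that by (induction T rule: finite_induct) (auto simp: coef coef0)
  show "independent B"
    unfolding independent_explicit_finite_subsets
  proof (intro allI impI ballI, rule ccontr)
    fix T u v
    assume T: "T \<subseteq> B" "finite T" and sum: "(\<Sum>v\<in>T. scale (u v) v) = 0" and v: "v \<in> T" "u v \<noteq> 0"
    let ?T = "{v \<in> T. u v \<noteq> 0}"
    have TX: "w \<in> V" "w \<noteq> 0" if "w \<in> T" for w using that T B by auto
    have "is_greatest lt (?l ` ?T) (greatest lt (?l ` ?T))"
      using T v lead(1)[OF TX] by (intro is_greatest_greatest[OF X(2)]) auto
    \<comment> \<open>The element with the largest leading monomial among those that occur in the relation.\<close>
    then obtain w where w: "w \<in> T" "u w \<noteq> 0" and gr: "is_greatest lt (?l ` ?T) (?l w)"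
      unfolding is_greatest_def by auto
    have "u z * coef z (?l w) = 0" if z: "z \<in> T - {w}" for z
    proof (rule ccontr)
      assume "u z * coef z (?l w) \<noteq> 0"
      then have "u z \<noteq> 0" "coef z (?l w) \<noteq> 0" by auto
      moreover have ne: "?l z \<noteq> ?l w"
        using z w T B(3) by (auto simp: inj_on_def)
      ultimately have 1: "lt (?l z) (?l w)" using gr z by (auto simp: is_greatest_def)
      have "lt (?l w) (?l z)" using lead(3)[OF TX, of z "?l w"] lead(1)[OF TX[OF w(1)]] z ne \<open>coef z (?l w) \<noteq> 0\<close> by auto
      with 1 show False using trans[of "?l z" "?l w" "?l z"] irrefl[of "?l z"] lead(1)[OF TX] z w by blast
    qed
    then have "(\<Sum>z\<in>T - {w}. u z * coef z (?l w)) = 0" by (simp add: sum.neutral)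
    then have "coef (\<Sum>v\<in>T. scale (u v) v) (?l w) = u w * coef w (?l w)"
      unfolding coef_sum[OF T(2)] by (subst sum.remove[OF T(2) w(1)]) simp
    then show False using sum w lead(2)[OF TX[OF w(1)]] by (simp add: coef0)
  qed
  have "f \<in> span B" if "f \<in> V" for f
    using that
  proof (induction "card {x \<in> X. lt x (?l f)}" arbitrary: f rule: less_induct)
    case less
    show ?case
    proof (cases "f = 0")
      case True then show ?thesis by (simp add: span_zero)
    next
      case False
      note f = less.prems False
      obtain b where b: "b \<in> B" "?l b = ?l f" using B(4)[OF f] by auto
      have bV: "b \<in> V" "b \<noteq> 0" using b B by auto
      \<comment> \<open>The multiple of \<open>b\<close> that cancels the leading term of \<open>f\<close>.\<close>
      define k where "k = coef f (?l f) / coef b (?l f)"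
      define h where "h = f - scale k b"
      have hV: "h \<in> V" using V(1) f bV by (simp add: h_def subspace_diff subspace_scale)
      have coef_h: "coef h x = coef f x - k * coef b x" for x
      proof -
        have "coef f x = coef (h + scale k b) x" by (simp add: h_def)
        then show ?thesis by (simp add: coef)
      qed
      have "h \<in> span B"
      proof (cases "h = 0")
        case True then show ?thesis by (simp add: span_zero)
      next
        case False
        note h = hV False
        have "coef h (?l f) = 0" using lead(2)[OF bV] b by (simp add: coef_h k_def)
        then have ne: "?l h \<noteq> ?l f" using lead(2)[OF h] by auto
        have "coef f (?l h) \<noteq> 0 \<or> coef b (?l h) \<noteq> 0" using lead(2)[OF h] by (auto simp: coef_h)
        then have lt: "lt (?l h) (?l f)"
          using lead(3)[OF f, of "?l h"] lead(3)[OF bV, of "?l h"] lead(1)[OF h] ne b by auto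
        have "{x \<in> X. lt x (?l h)} \<subset> {x \<in> X. lt x (?l f)}"
          using lt trans[OF _ lt] lead(1)[OF h] lead(1)[OF f] irrefl by blast
        then have "card {x \<in> X. lt x (?l h)} < card {x \<in> X. lt x (?l f)}"
          using X(1) by (intro psubset_card_mono) auto
        then show ?thesis using less.hyps hV by blast
      qed
      moreover have "f = h + scale k b" by (simp add: h_def)
      ultimately show ?thesis using b by (metis span_add span_base span_scale)
    qed
  qed
  then show "span B = V" using span_minimal[OF B(1) V(1)] by auto
qed


lemma coset_eq_iff:
  assumes "subspace W"
  shows "x +o W = y +o W \<longleftrightarrow> x - y \<in> W"
proof
  assume "x +o W = y +o W"
  then show "x - y \<in> W" using subspace_0[OF assms] set_plus_intro2[of 0 W x]
    by (simp add: set_minus_plus)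
next
  assume xy: "x - y \<in> W"
  have "z - x \<in> W \<longleftrightarrow> z - y \<in> W" for z
  proof -
    have "z - y = (z - x) + (x - y)" "z - x = (z - y) - (x - y)" by simp_all
    then show ?thesis using xy subspace_add[OF assms] subspace_diff[OF assms] by metis
  qed
  then show "x +o W = y +o W" by (auto simp: set_minus_plus[symmetric])
qed

text \<open>
  A multiple of a coset is a coset of the multiple only up to a subset of \<open>W\<close> (for the scalar
  zero it is \<open>{0}\<close>).  The summand \<open>W\<close> of \<^const>\<open>quotient_lincomb\<close> fills each of these sets up to a
  full coset, so the linear combination can be computed on representatives.
\<close>

lemma quotient_lincomb_cosets:
  assumes W: "subspace W" and T: "finite T" "inj_on (\<lambda>x. x +o W) T"
  shows "quotient_lincomb scale W ((\<lambda>x. x +o W) ` T) a = (\<Sum>x\<in>T. scale (a (x +o W)) x) +o W"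
proof -
  have WW: "W + W = W"
    using W by (auto simp: set_plus_def subspace_def) (metis add.right_neutral)
  have elt: "y +o A = (+) y ` A" for y :: 'b and A
    by (auto simp: elt_set_plus_def)
  have scl: "scale c ` (x +o W) + W = scale c x +o W" for c x
  proof -
    have "scale c ` (x +o W) = scale c x +o (scale c ` W)"
      unfolding elt by (simp add: image_image scale_right_distrib)
    moreover have "scale c ` W + W = W"
      using W by (auto simp: set_plus_def subspace_def) (metis add_0 scale_zero_right)
    ultimately show ?thesis by (simp add: set_plus_rearranges set_plus_rearrange3)
  qed
  have "W + (\<Sum>x\<in>T. scale (a (x +o W)) ` (x +o W)) = (\<Sum>x\<in>T. scale (a (x +o W)) x) +o W"
    using T(1)
  proof (induction T rule: finite_induct)
    case empty
    then show ?case by simp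
  next
    case (insert x T)
    have "W + (\<Sum>x\<in>insert x T. scale (a (x +o W)) ` (x +o W)) =
        scale (a (x +o W)) ` (x +o W) + (W + (\<Sum>x\<in>T. scale (a (x +o W)) ` (x +o W)))"
      by (simp only: sum.insert[OF insert(1,2)] add.left_commute)
    also have "\<dots> = scale (a (x +o W)) ` (x +o W) + (W + ((\<Sum>x\<in>T. scale (a (x +o W)) x) +o W))"
      unfolding insert.IH[symmetric] by (simp add: WW add.assoc[symmetric])
    also have "\<dots> = (scale (a (x +o W)) x +o W) + ((\<Sum>x\<in>T. scale (a (x +o W)) x) +o W)"
      by (simp add: add.assoc[symmetric] scl)
    also have "\<dots> = (\<Sum>x\<in>insert x T. scale (a (x +o W)) x) +o W"
      using insert by (simp add: set_plus_rearrange WW)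
    finally show ?case .
  qed
  then show ?thesis
    by (simp add: quotient_lincomb_def sum.reindex[OF T(2)] o_def)
qed

text \<open>
  A basis \<open>B\<close> of \<open>V\<close> that contains a basis \<open>B'\<close> of \<open>W\<close> induces a basis of \<open>V/W\<close>:
  elements of \<open>B'\<close> become zero, and a linear relation modulo \<open>W\<close> between elements of \<open>B - B'\<close> is
  a relation between elements of \<open>B\<close>.
\<close>

lemma nested_bases_quotient_basis:
  assumes B: "independent B" "span B = V" and B': "B' \<subseteq> B" "span B' = W"
  shows "is_quotient_basis scale V W ((\<lambda>x. x +o W) ` (B - B'))"
proof -
  let ?q = "\<lambda>x. x +o W"
  have W: "subspace W" using B'(2) subspace_span by blast
  have inj: "inj_on ?q (B - B')"
  proof (rule inj_onI, rule ccontr)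
    fix x y assume xy: "x \<in> B - B'" "y \<in> B - B'" "x +o W = y +o W" "x \<noteq> y"
    have "x - y \<in> span (B - {x})"
      using xy B' span_mono[of B' "B - {x}"] by (auto simp: coset_eq_iff[OF W])
    moreover have "y \<in> span (B - {x})" using xy by (intro span_base) auto
    ultimately have "x \<in> span (B - {x})" using span_add[of "x - y" _ y] by simp
    then show False using B(1) xy by (auto simp: dependent_def)
  qed
  show ?thesis
    unfolding is_quotient_basis_def
  proof (intro conjI allI impI ballI)
    show "?q ` (B - B') \<subseteq> quotient_space V W"
      using B by (auto simp: quotient_space_def intro: span_base)
  next
    fix T a C assume T: "finite T \<and> T \<subseteq> ?q ` (B - B') \<and> quotient_lincomb scale W T a = W" and C: "C \<in> T"
    from T obtain U where U: "U \<subseteq> B - B'" "inj_on ?q U" "T = ?q ` U"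
      unfolding subset_image_inj by auto
    have fin: "finite U" using T U finite_imageD by blast
    let ?s = "\<Sum>x\<in>U. scale (a (?q x)) x"
    have "?s +o W = 0 +o W" using T quotient_lincomb_cosets[OF W fin U(2)] U(3) by simp
    then have "?s \<in> span B'" using B' by (simp add: coset_eq_iff[OF W] del: set_zero_plus)
    then obtain R r where R: "finite R" "R \<subseteq> B'" "?s = (\<Sum>x\<in>R. scale (r x) x)"
      unfolding span_explicit by auto
    \<comment> \<open>One relation in \<open>B\<close> that combines the sum over \<open>U\<close> with the element of \<open>span B'\<close> that it equals.\<close>
    define u where "u x = (if x \<in> R then - r x else a (?q x))" for x
    have disj: "U \<inter> R = {}" using U R by auto
    have "(\<Sum>x\<in>U. scale (u x) x) = ?s"
      using disj by (intro sum.cong) (auto simp: u_def)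
    moreover have "(\<Sum>x\<in>R. scale (u x) x) = - (\<Sum>x\<in>R. scale (r x) x)"
      by (simp add: u_def sum_negf)
    ultimately have "(\<Sum>x\<in>U \<union> R. scale (u x) x) = 0"
      using R by (simp add: sum.union_disjoint[OF fin R(1) disj])
    moreover obtain x where "x \<in> U" "C = ?q x" using C U by auto
    ultimately have "u x = 0"
      using independentD[OF B(1), of "U \<union> R" u x] fin R U B' by auto
    then show "a C = 0" using \<open>x \<in> U\<close> \<open>C = ?q x\<close> disj by (auto simp: u_def disjoint_iff)
  next
    fix C assume "C \<in> quotient_space V W"
    then obtain x where x: "x \<in> span B" "C = ?q x" using B by (auto simp: quotient_space_def)
    then obtain R r where R: "finite R" "R \<subseteq> B" "x = (\<Sum>x\<in>R. scale (r x) x)"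
      unfolding span_explicit by auto
    define U where "U = R - B'"
    have U: "finite U" "U \<subseteq> B - B'" using R by (auto simp: U_def)
    have injU: "inj_on ?q U" using inj U inj_on_subset by blast
    define a where "a D = r (inv_into U ?q D)" for D
    have "(\<Sum>x\<in>U. scale (a (?q x)) x) = (\<Sum>x\<in>U. scale (r x) x)"
      by (intro sum.cong) (simp_all add: a_def inv_into_f_f[OF injU])
    moreover have "x = (\<Sum>x\<in>U. scale (r x) x) + (\<Sum>x\<in>R \<inter> B'. scale (r x) x)"
      unfolding R(3) U_def using R(1) by (subst sum.Int_Diff[of R _ B']) (auto simp: add.commute)
    moreover have "(\<Sum>x\<in>R \<inter> B'. scale (r x) x) \<in> W"
      unfolding B'(2)[symmetric] by (intro span_sum span_scale span_base) auto
    ultimately have "C = (\<Sum>x\<in>U. scale (a (?q x)) x) +o W"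
      using x(2) by (simp add: coset_eq_iff[OF W])
    then have "C = quotient_lincomb scale W (?q ` U) a"
      using quotient_lincomb_cosets[OF W U(1) injU] by simp
    then show "\<exists>T a. finite T \<and> T \<subseteq> ?q ` (B - B') \<and> C = quotient_lincomb scale W T a"
      using U by (intro exI[of _ "?q ` U"] exI[of _ a]) auto
  qed
qed

end

section \<open>Radicals\<close>

lemma right_submoduleD:
  fixes ract :: "'m::ab_group_add \<Rightarrow> 'a \<Rightarrow> 'm"
  assumes "right_submodule ract N M"
  shows "x \<in> N \<Longrightarrow> x \<in> M" "0 \<in> N" "x \<in> N \<Longrightarrow> y \<in> N \<Longrightarrow> x + y \<in> N"
    "x \<in> N \<Longrightarrow> - x \<in> N" "x \<in> N \<Longrightarrow> ract x a \<in> N"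
  using assms by (auto simp: right_submodule_def)

lemma right_submoduleI:
  fixes ract :: "'m::ab_group_add \<Rightarrow> 'a \<Rightarrow> 'm"
  assumes "N \<subseteq> M" "0 \<in> N" "\<And>x y. x \<in> N \<Longrightarrow> y \<in> N \<Longrightarrow> x + y \<in> N"
    "\<And>x. x \<in> N \<Longrightarrow> - x \<in> N" "\<And>x a. x \<in> N \<Longrightarrow> ract x a \<in> N"
  shows "right_submodule ract N M"
  using assms by (auto simp: right_submodule_def)

text \<open>
  This covers both the free module \<open>F\<close> and the regular right module of the algebra, on which the
  action is the multiplication itself.
\<close>

locale right_action =
  fixes ract :: "'m::ab_group_add \<Rightarrow> 'a::{ring, monoid_mult} \<Rightarrow> 'm"
  assumes ract_add_left: "ract (x + y) a = ract x a + ract y a"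
    and ract_add_right: "ract x (a + b) = ract x a + ract x b"
    and ract_assoc: "ract (ract x a) b = ract x (a * b)"
    and ract_one: "ract x 1 = x"
begin

lemma ract_zero_right: "ract x 0 = 0"
  using ract_add_right[of x 0 0] by simp

lemma ract_zero_left: "ract 0 a = 0"
  using ract_add_left[of 0 0 a] by simp

lemma ract_minus_right: "ract x (- a) = - ract x a"
  using ract_add_right[of x a "- a"] by (simp add: ract_zero_right eq_neg_iff_add_eq_0 add.commute[of _ "ract x a"])

lemma ract_sum_right: "ract x (sum f T) = (\<Sum>t\<in>T. ract x (f t))"
  by (induction T rule: infinite_finite_induct) (auto simp: ract_zero_right ract_add_right)

lemma ract_sum_left: "ract (sum f T) a = (\<Sum>t\<in>T. ract (f t) a)"
  by (induction T rule: infinite_finite_induct) (auto simp: ract_zero_left ract_add_left)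

text \<open>
  For \<open>x\<close> outside the maximal submodule \<open>N\<close>, the annihilator of \<open>x\<close> modulo \<open>N\<close> is a maximal right
  ideal, because \<open>M/N\<close> is simple.  It therefore contains the Jacobson radical.
\<close>

lemma maximal_submodule_absorbs_radical:
  assumes M: "right_submodule ract M M" and N: "maximal_submodule ract N M"
    and x: "x \<in> M" and a: "a \<in> Rad (*) (UNIV :: 'a set)"
  shows "ract x a \<in> N"
proof (cases "x \<in> N")
  case True
  then show ?thesis using N by (auto simp: maximal_submodule_def right_submodule_def)
next
  case False
  define I where "I = {a. ract x a \<in> N}"
  have Nsub: "right_submodule ract N M" using N by (simp add: maximal_submodule_def)
  have I: "right_submodule (*) I UNIV"
    using right_submoduleD[OF Nsub] by (intro right_submoduleI)
      (simp_all add: I_def ract_zero_right ract_add_right ract_minus_right ract_assoc[symmetric])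
  have "1 \<notin> I" using False by (simp add: I_def ract_one)
  have "maximal_submodule (*) I UNIV"
    unfolding maximal_submodule_def
  proof (intro conjI allI impI)
    show "right_submodule (*) I UNIV" by (rule I)
    show "I \<noteq> UNIV" using \<open>1 \<notin> I\<close> by auto
    fix I' assume I': "right_submodule (*) I' UNIV \<and> I \<subseteq> I'"
    show "I' = I \<or> I' = UNIV"
    proof (rule disjCI)
      assume "I' \<noteq> UNIV"
      have I'r: "right_submodule (*) I' UNIV" "I \<subseteq> I'" using I' by auto
      have "1 \<notin> I'"
      proof
        assume "1 \<in> I'"
        then have "1 * b \<in> I'" for b by (rule right_submoduleD(5)[OF I'r(1)])
        then show False using \<open>I' \<noteq> UNIV\<close> by auto
      qed
      define N' where "N' = {n + ract x b | n b. n \<in> N \<and> b \<in> I'}"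
      have N'I: "n + ract x b \<in> N'" if "n \<in> N" "b \<in> I'" for n b
        using that by (auto simp: N'_def)
      have NN': "N \<subseteq> N'"
      proof
        fix n assume "n \<in> N"
        then show "n \<in> N'" using N'I[OF _ right_submoduleD(2)[OF I'r(1)], of n] by (simp add: ract_zero_right)
      qed
      have "right_submodule ract N' M"
      proof (rule right_submoduleI)
        show "N' \<subseteq> M"
          using right_submoduleD(1)[OF Nsub] right_submoduleD(3,5)[OF M] x by (auto simp: N'_def)
        show "0 \<in> N'" using NN' right_submoduleD(2)[OF Nsub] by auto
        fix y assume "y \<in> N'"
        then obtain n b where y: "y = n + ract x b" "n \<in> N" "b \<in> I'" by (auto simp: N'_def)
        have "- y = - n + ract x (- b)" by (simp add: y ract_minus_right)
        then show "- y \<in> N'"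
          using N'I[OF right_submoduleD(4)[OF Nsub y(2)] right_submoduleD(4)[OF I'r(1) y(3)]] by simp
        show "ract y a \<in> N'" for a
        proof -
          have "ract y a = ract n a + ract x (b * a)" by (simp add: y ract_add_left ract_assoc)
          then show ?thesis
            using N'I[OF right_submoduleD(5)[OF Nsub y(2)] right_submoduleD(5)[OF I'r(1) y(3)]] by simp
        qed
        fix z assume "z \<in> N'"
        then obtain m c where z: "z = m + ract x c" "m \<in> N" "c \<in> I'" by (auto simp: N'_def)
        have "y + z = (n + m) + ract x (b + c)" by (simp add: y z ract_add_right)
        then show "y + z \<in> N'"
          using N'I[OF right_submoduleD(3)[OF Nsub y(2) z(2)] right_submoduleD(3)[OF I'r(1) y(3) z(3)]]
          by simp
      qed
      moreover note NN'
      ultimately have "N' = N \<or> N' = M" using N by (simp add: maximal_submodule_def)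
      moreover have "N' \<noteq> M"
      proof
        assume "N' = M"
        then obtain n b where nb: "x = n + ract x b" "n \<in> N" "b \<in> I'" using x by (auto simp: N'_def)
        have "n = ract x (1 - b)"
        proof -
          have "ract x b + ract x (1 - b) = n + ract x b"
            using ract_add_right[of x b "1 - b"] nb(1) by (simp add: ract_one)
          then show ?thesis by (simp add: add.commute)
        qed
        then have "1 - b \<in> I'" using nb I'r(2) by (auto simp: I_def)
        then have "(1 - b) + b \<in> I'" using right_submoduleD(3)[OF I'r(1) _ nb(3)] by blast
        then show False using \<open>1 \<notin> I'\<close> by simp
      qed
      ultimately have "N' = N" by blast
      have "ract x b \<in> N" if "b \<in> I'" for b
      proof -
        have "0 + ract x b \<in> N'" using N'I[OF right_submoduleD(2)[OF Nsub] that] .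
        then show ?thesis using \<open>N' = N\<close> by simp
      qed
      then show "I' = I" using I' by (auto simp: I_def)
    qed
  qed
  then have "a \<in> I" using a by (auto simp: Rad_def)
  then show ?thesis by (simp add: I_def)
qed

end

text \<open>
  A module over an algebra: the scalars act both on the vector space and, through \<open>scalar\<close>, as
  elements of the algebra.
\<close>

locale right_vector_action = right_action ract + vector_space scl
  for ract :: "'m::ab_group_add \<Rightarrow> 'a::{ring, monoid_mult} \<Rightarrow> 'm"
    and scl :: "'k::field \<Rightarrow> 'm \<Rightarrow> 'm" +
  fixes scalar :: "'k \<Rightarrow> 'a"
  assumes scl_eq_ract: "scl k x = ract x (scalar k)"
    and ract_scl: "ract (scl k x) a = scl k (ract x a)"
begin

text \<open>
  Submodules are closed under scalars because a scalar acts like its image in the algebra.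
\<close>

lemma right_submodule_scl: "right_submodule ract N M \<Longrightarrow> x \<in> N \<Longrightarrow> scl k x \<in> N"
  by (simp add: right_submodule_def scl_eq_ract)

lemma right_submodule_subspace:
  assumes "right_submodule ract N M"
  shows "subspace N"
proof (rule subspaceI)
  show "0 \<in> N" "x \<in> N \<Longrightarrow> y \<in> N \<Longrightarrow> x + y \<in> N" "x \<in> N \<Longrightarrow> scl c x \<in> N" for x y c
    by (fact right_submoduleD(2)[OF assms], fact right_submoduleD(3)[OF assms],
        fact right_submodule_scl[OF assms])
qed

text \<open>
  The hypothesis on \<open>e\<close> says that, modulo \<open>N\<close>, every \<open>e v\<close> maps each element of \<open>M\<close> to zero or
  to a common eigenvector of the algebra.  As the \<open>e v\<close> sum up to 1, these span \<open>M/N\<close>, which is therefore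
  semisimple, and the radical of \<open>M/N\<close> is zero.  Concretely: an element \<open>x\<close> outside \<open>N\<close> has some
  \<open>y = x \<cdot> e v\<close> outside \<open>N\<close>, and a submodule \<open>W\<close> containing \<open>N\<close> that is maximal among those without \<open>y\<close>
  is already a maximal submodule.  It does not contain \<open>x\<close>.
\<close>

lemma Rad_subset_if_semisimple_quotient:
  assumes M: "right_submodule ract M M" and N: "right_submodule ract N M"
    and e: "(\<Sum>v\<in>V. e v) = 1"
    and eig: "\<And>x v a. x \<in> M \<Longrightarrow> v \<in> V \<Longrightarrow>
      \<exists>k. ract (ract x (e v)) a - scl k (ract x (e v)) \<in> N"
  shows "Rad ract M \<subseteq> N"
proof (rule subsetI, rule ccontr)
  fix x assume x: "x \<in> Rad ract M" "x \<notin> N"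
  have xM: "x \<in> M" using x by (simp add: Rad_def)
  have decomp: "z = (\<Sum>v\<in>V. ract z (e v))" for z
    using ract_sum_right[of z e V] by (simp add: e ract_one)
  have sum_mem: "z \<in> U" if "right_submodule ract U M" "\<And>v. v \<in> V \<Longrightarrow> ract z (e v) \<in> U" for z U
    by (subst decomp, rule subspace_sum[OF right_submodule_subspace[OF that(1)] that(2)])
  obtain v where v: "v \<in> V" "ract x (e v) \<notin> N" using sum_mem[OF N] x(2) by blast
  define y where "y = ract x (e v)"
  define \<W> where "\<W> = {W. right_submodule ract W M \<and> N \<subseteq> W \<and> y \<notin> W}"
  have "\<exists>W\<in>\<W>. \<forall>W'\<in>\<W>. W \<subseteq> W' \<longrightarrow> W' = W"
  proof (rule subset_Zorn)
    fix \<C> assume chain: "subset.chain \<W> \<C>"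
    have \<C>: "\<And>W. W \<in> \<C> \<Longrightarrow> right_submodule ract W M \<and> N \<subseteq> W \<and> y \<notin> W"
      "\<And>W W'. W \<in> \<C> \<Longrightarrow> W' \<in> \<C> \<Longrightarrow> W \<subseteq> W' \<or> W' \<subseteq> W"
      using chain by (auto simp: subset_chain_def \<W>_def)
    show "\<exists>U\<in>\<W>. \<forall>W\<in>\<C>. W \<subseteq> U"
    proof (cases "\<C> = {}")
      case True
      have "N \<in> \<W>" using N v by (simp add: \<W>_def y_def)
      then show ?thesis using True by auto
    next
      case False
      have sub: "right_submodule ract W M" if "W \<in> \<C>" for W using \<C>(1)[OF that] by simp
      have add: "a + b \<in> \<Union>\<C>" if ab: "a \<in> \<Union>\<C>" "b \<in> \<Union>\<C>" for a b
      proof -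
        obtain A B where AB: "A \<in> \<C>" "B \<in> \<C>" "a \<in> A" "b \<in> B" using ab by blast
        then obtain C where "C \<in> \<C>" "a \<in> C" "b \<in> C" using \<C>(2)[OF AB(1,2)] by blast
        then show ?thesis using right_submoduleD(3)[OF sub, of C a b] by blast
      qed
      have "right_submodule ract (\<Union>\<C>) M"
      proof (rule right_submoduleI)
        show "\<Union>\<C> \<subseteq> M" using right_submoduleD(1)[OF sub] by (intro Union_least subsetI)
        obtain C where "C \<in> \<C>" using False by blast
        then show "0 \<in> \<Union>\<C>" using right_submoduleD(2)[OF sub] by (intro UnionI)
        show "a + b \<in> \<Union>\<C>" if "a \<in> \<Union>\<C>" "b \<in> \<Union>\<C>" for a b using add that .
        show "- a \<in> \<Union>\<C>" if "a \<in> \<Union>\<C>" for a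
          using that by (elim UnionE) (rule UnionI, assumption, rule right_submoduleD(4)[OF sub])
        show "ract a b \<in> \<Union>\<C>" if "a \<in> \<Union>\<C>" for a b
          using that by (elim UnionE) (rule UnionI, assumption, rule right_submoduleD(5)[OF sub])
      qed
      then have "\<Union>\<C> \<in> \<W>" using \<C>(1) False by (auto simp: \<W>_def)
      then show ?thesis by blast
    qed
  qed
  then obtain W where "W \<in> \<W>" and max: "\<forall>W'\<in>\<W>. W \<subseteq> W' \<longrightarrow> W' = W" by blast
  then have W: "right_submodule ract W M" "N \<subseteq> W" "y \<notin> W" by (simp_all add: \<W>_def)
  have Wmax: "y \<in> W'" if "right_submodule ract W' M" "W \<subseteq> W'" "W' \<noteq> W" for W'
    using max[rule_format, of W'] that W(2) by (auto simp: \<W>_def)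
  have yM: "y \<in> M" unfolding y_def by (rule right_submoduleD(5)[OF M xM])
  have "maximal_submodule ract W M"
    unfolding maximal_submodule_def
  proof (intro conjI allI impI)
    show "right_submodule ract W M" by (rule W)
    show "W \<noteq> M" using W yM by auto
    fix W' assume W': "right_submodule ract W' M \<and> W \<subseteq> W'"
    show "W' = W \<or> W' = M"
    proof (rule disjCI)
      assume "W' \<noteq> M"
      show "W' = W"
      proof (rule ccontr)
        assume "W' \<noteq> W"
        then have "y \<in> W'" using Wmax[of W'] W' by simp
        \<comment> \<open>Every eigenvector outside \<open>W\<close> enlarges \<open>W\<close> to a submodule containing \<open>y\<close>, so it is congruent
          to a multiple of \<open>y\<close> modulo \<open>W\<close>.\<close>
        have *: "ract m (e w) \<in> W'" if m: "m \<in> M" and w: "w \<in> V" for m w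
        proof (cases "ract m (e w) \<in> W")
          case True
          then show ?thesis using W' by auto
        next
          case False
          let ?z = "ract m (e w)"
          \<comment> \<open>The eigenvector condition makes \<open>U\<close> a submodule, although only a single vector is added to \<open>W\<close>.\<close>
          define U where "U = {u + scl k ?z | u k. u \<in> W}"
          have UI: "u + scl k ?z \<in> U" if "u \<in> W" for u k
            using that by (auto simp: U_def)
          note Ws = right_submodule_subspace[OF W(1)]
          have zM: "?z \<in> M" by (rule right_submoduleD(5)[OF M m])
          have "right_submodule ract U M"
          proof (rule right_submoduleI)
            show "U \<subseteq> M"
              unfolding U_def using right_submoduleD(1)[OF W(1)] right_submodule_scl[OF M zM]
              by (clarsimp) (rule right_submoduleD(3)[OF M])
            show "0 \<in> U" using UI[OF subspace_0[OF Ws], of 0] by simp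
            fix a assume "a \<in> U"
            then obtain u k where a: "a = u + scl k ?z" "u \<in> W" by (auto simp: U_def)
            have "- a = - u + scl (- k) ?z" by (simp add: a)
            then show "- a \<in> U" by (simp only: UI subspace_neg[OF Ws a(2)])
            show "ract a b \<in> U" for b
            proof -
              obtain l where l: "ract ?z b - scl l ?z \<in> N" using eig[OF m w] by blast
              have "ract a b = (ract u b + scl k (ract ?z b - scl l ?z)) + scl (k * l) ?z"
                by (simp add: a ract_add_left ract_scl scale_right_diff_distrib)
              moreover have "ract u b \<in> W" by (rule right_submoduleD(5)[OF W(1) a(2)])
              then have "ract u b + scl k (ract ?z b - scl l ?z) \<in> W"
                using l W Ws by (intro subspace_add[OF Ws] subspace_scale[OF Ws]) auto
              ultimately show ?thesis by (simp only: UI)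
            qed
            fix b assume "b \<in> U"
            then obtain u' k' where b: "b = u' + scl k' ?z" "u' \<in> W" by (auto simp: U_def)
            have "a + b = (u + u') + scl (k + k') ?z" by (simp add: a b scale_left_distrib)
            then show "a + b \<in> U" by (simp only: UI subspace_add[OF Ws a(2) b(2)])
          qed
          moreover have "W \<subseteq> U"
          proof
            fix u assume "u \<in> W"
            then show "u \<in> U" using UI[of u 0] by simp
          qed
          moreover have "?z \<in> U" using UI[OF subspace_0[OF Ws], of 1] by simp
          moreover have "U \<noteq> W" using False \<open>?z \<in> U\<close> by auto
          ultimately have "y \<in> U" using Wmax[of U] by simp
          then obtain u k where uk: "y = u + scl k ?z" "u \<in> W" by (auto simp: U_def)
          then have "k \<noteq> 0" using W by auto
          then have "?z = scl (inverse k) (y - u)" using uk by simp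
          moreover have sW': "subspace W'" using W' right_submodule_subspace[of W'] by auto
          have "scl (inverse k) (y - u) \<in> W'"
            using \<open>y \<in> W'\<close> uk(2) W' by (intro subspace_scale[OF sW'] subspace_diff[OF sW']) auto
          ultimately show ?thesis by simp
        qed
        have "z \<in> W'" if "z \<in> M" for z
        proof (rule sum_mem)
          show "right_submodule ract W' M" using W' by simp
          show "ract z (e v) \<in> W'" if "v \<in> V" for v by (rule *[OF \<open>z \<in> M\<close> that])
        qed
        moreover have "W' \<subseteq> M" using W' by (simp add: right_submodule_def)
        ultimately show False using \<open>W' \<noteq> M\<close> by blast
      qed
    qed
  qed
  then have "x \<in> W" using x by (auto simp: Rad_def)
  then have "y \<in> W" unfolding y_def by (rule right_submoduleD(5)[OF W(1)])
  then show False using W by simp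
qed

end

section \<open>Paths\<close>

lemma path_deg_concat: "path_deg (path_concat b c) = path_deg b + path_deg c"
  by (simp add: path_deg_def path_concat_def)

lemma path_concat_right_cancel: "path_concat b c = path_concat b' c \<longleftrightarrow> b = b'"
  by (cases b; cases b') (simp add: path_concat_def)

lemma path_concat_left_cancel:
  "composable Q a b \<Longrightarrow> composable Q a b' \<Longrightarrow> path_concat a b = path_concat a b' \<longleftrightarrow> b = b'"
  by (cases b; cases b') (auto simp: path_concat_def composable_def)

context wf_digraph
begin

lemma path_iff_awalk: "b \<in> paths G \<longleftrightarrow> awalk (fst b) (snd b) (path_end G b)"
  by (cases b) (auto simp: paths_def path_end_def)

lemma path_concat_closed:
  assumes "b \<in> paths G" "c \<in> paths G" "composable G b c"
  shows "path_concat b c \<in> paths G" "path_end G (path_concat b c) = path_end G c"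
proof -
  have "awalk (fst b) (snd b @ snd c) (path_end G c)"
    using assms by (auto simp: path_iff_awalk composable_def intro: awalk_appendI)
  then show "path_concat b c \<in> paths G" "path_end G (path_concat b c) = path_end G c"
    by (auto simp: path_concat_def paths_def path_end_def)
qed

lemma path_splitE:
  assumes "(u, p @ q) \<in> paths G"
  obtains w where "(u, p) \<in> paths G" "(w, q) \<in> paths G" "composable G (u, p) (w, q)"
    "path_end G (w, q) = path_end G (u, p @ q)"
proof -
  obtain v where v: "awalk u (p @ q) v" using assms by (auto simp: paths_def)
  then have "awalk u p (awlast u p)" "awalk (awlast u p) q v" by auto
  then show ?thesis
    using v by (intro that[of "awlast u p"]) (auto simp: paths_def composable_def path_end_def)
qed

lemma trivial_path: "v \<in> verts G \<Longrightarrow> (v, []) \<in> paths G"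
  by (auto simp: paths_def awalk_Nil_iff)

lemma path_start_in_verts: "b \<in> paths G \<Longrightarrow> fst b \<in> verts G"
  by (auto simp: path_iff_awalk dest: awalk_hd_in_verts)

lemma path_deg_0: "b \<in> paths G \<Longrightarrow> path_deg b = 0 \<Longrightarrow> b = (path_end G b, [])"
  by (cases b) (auto simp: path_deg_def path_iff_awalk awalk_Nil_iff)

text \<open>
  Powers of the arrow ideal are compared by splitting off the last arrow of a path.
\<close>

lemma path_last_arrowE:
  assumes "b \<in> paths G" "path_deg b = Suc k"
  obtains b' e where "b' \<in> paths G" "e \<in> arcs G" "composable G b' (tail G e, [e])"
    "b = path_concat b' (tail G e, [e])" "path_deg b' = k"
proof -
  obtain u p where b: "b = (u, p)" by (cases b)
  then obtain p' e where p: "p = p' @ [e]" using assms(2) by (cases p rule: rev_cases) (auto simp: path_deg_def)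
  obtain w where w: "(u, p') \<in> paths G" "(w, [e]) \<in> paths G" "composable G (u, p') (w, [e])"
    using path_splitE[of u p' "[e]"] assms b p by auto
  then have "e \<in> arcs G" "w = tail G e" by (auto simp: paths_def awalk_Cons_iff)
  then show ?thesis using w b p assms(2) by (intro that[of "(u, p')" e]) (auto simp: path_concat_def path_deg_def)
qed

lemma arrow_path: "e \<in> arcs G \<Longrightarrow> (tail G e, [e]) \<in> paths G"
  by (auto simp: paths_def intro!: exI[of _ "head G e"] arc_implies_awalk)

end

lemma (in fin_digraph) finite_paths_of_bounded_degree: "finite {b \<in> paths G. path_deg b \<le> n}"
proof (rule finite_subset)
  show "{b \<in> paths G. path_deg b \<le> n} \<subseteq> verts G \<times> {p. set p \<subseteq> arcs G \<and> length p \<le> n}"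
    by (auto simp: path_iff_awalk path_deg_def awalk_def dest: path_start_in_verts)
  show "finite (verts G \<times> {p. set p \<subseteq> arcs G \<and> length p \<le> n})"
    by (intro finite_cartesian_product finite_lists_length_le) auto
qed

section \<open>Path algebra\<close>

lemma lookup_pa_scale: "Poly_Mapping.lookup (pa_scale k p) b = k * Poly_Mapping.lookup p b"
  by (simp add: pa_scale_def Poly_Mapping.map.rep_eq when_def)

lemma pa_scale_single: "pa_scale k (Poly_Mapping.single b c) = Poly_Mapping.single b (k * c)"
  by (rule poly_mapping_eqI) (simp add: lookup_pa_scale lookup_single when_def)

lemma pa_mult_single_right:
  fixes p :: "('v, 'e) path \<Rightarrow>\<^sub>0 'k::field"
  shows "pa_mult Q p (Poly_Mapping.single c 1) =
    (\<Sum>b\<in>{b \<in> Poly_Mapping.keys p. composable Q b c}.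
      Poly_Mapping.single (path_concat b c) (Poly_Mapping.lookup p b))"
  by (simp add: pa_mult_def sum.inter_filter cong: if_cong)

lemma pa_mult_single_left:
  fixes p :: "('v, 'e) path \<Rightarrow>\<^sub>0 'k::field"
  shows "pa_mult Q (Poly_Mapping.single a 1) p =
    (\<Sum>b\<in>{b \<in> Poly_Mapping.keys p. composable Q a b}.
      Poly_Mapping.single (path_concat a b) (Poly_Mapping.lookup p b))"
  by (simp add: pa_mult_def sum.inter_filter cong: if_cong)

lemma pa_mult_single_single:
  "pa_mult Q (Poly_Mapping.single b \<alpha>) (Poly_Mapping.single c \<beta>) =
    (if composable Q b c then Poly_Mapping.single (path_concat b c) (\<alpha> * \<beta> :: 'k::field) else 0)"
  by (cases "\<alpha> = 0"; cases "\<beta> = 0") (simp_all add: pa_mult_def)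

lemma pa_mult_zero_left: "pa_mult Q 0 q = 0"
  by (simp add: pa_mult_def)

text \<open>
  Multiplication by a fixed path is injective on the paths that it does not kill.  Hence no
  cancellation occurs when an element of the path algebra is multiplied by a path.
\<close>

lemma lookup_sum_single_inj:
  assumes "finite B" "inj_on h B"
  shows "Poly_Mapping.lookup (\<Sum>b\<in>B. Poly_Mapping.single (h b) (f b :: 'k::comm_monoid_add)) t =
    (if t \<in> h ` B then f (inv_into B h t) else 0)"
proof -
  have "Poly_Mapping.lookup (\<Sum>b\<in>B. Poly_Mapping.single (h b) (f b)) t
      = (\<Sum>b\<in>B. if h b = t then f b else 0)"
    by (simp add: lookup_sum lookup_single when_def)
  also have "\<dots> = (if t \<in> h ` B then f (inv_into B h t) else 0)"
  proof (cases "t \<in> h ` B")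
    case True
    then obtain b where b: "b \<in> B" "t = h b" by auto
    have "(\<Sum>b'\<in>B. if h b' = t then f b' else 0) = (\<Sum>b'\<in>B. if b' = b then f b' else 0)"
      using b assms(2) by (intro sum.cong) (auto simp: inj_on_def)
    then show ?thesis using assms b by simp
  next
    case False
    then show ?thesis by (auto intro!: sum.neutral)
  qed
  finally show ?thesis .
qed

lemma lookup_mult_right:
  fixes p :: "('v, 'e) path \<Rightarrow>\<^sub>0 'k::field"
  assumes "composable Q b c"
  shows "Poly_Mapping.lookup (pa_mult Q p (Poly_Mapping.single c 1)) (path_concat b c) = Poly_Mapping.lookup p b"
proof -
  let ?B = "{b \<in> Poly_Mapping.keys p. composable Q b c}"
  have inj: "inj_on (\<lambda>b. path_concat b c) ?B" by (simp add: inj_on_def path_concat_right_cancel)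
  have "path_concat b c \<in> (\<lambda>b. path_concat b c) ` ?B \<longleftrightarrow> b \<in> ?B"
    by (auto simp: path_concat_right_cancel)
  then show ?thesis unfolding pa_mult_single_right
    using assms inv_into_f_f[OF inj, of b] by (subst lookup_sum_single_inj[OF _ inj]) (auto simp: in_keys_iff)
qed

lemma keys_mult_right:
  fixes p :: "('v, 'e) path \<Rightarrow>\<^sub>0 'k::field"
  assumes "t \<in> Poly_Mapping.keys (pa_mult Q p (Poly_Mapping.single c 1))"
  obtains b where "b \<in> Poly_Mapping.keys p" "composable Q b c" "t = path_concat b c"
proof -
  let ?B = "{b \<in> Poly_Mapping.keys p. composable Q b c}"
  have inj: "inj_on (\<lambda>b. path_concat b c) ?B" by (simp add: inj_on_def path_concat_right_cancel)
  have "t \<in> (\<lambda>b. path_concat b c) ` ?B"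
    using assms unfolding pa_mult_single_right in_keys_iff[of t]
    by (subst (asm) lookup_sum_single_inj[OF _ inj]) (auto split: if_splits)
  then show ?thesis using that by auto
qed

lemma lookup_mult_left:
  fixes p :: "('v, 'e) path \<Rightarrow>\<^sub>0 'k::field"
  assumes "composable Q a b"
  shows "Poly_Mapping.lookup (pa_mult Q (Poly_Mapping.single a 1) p) (path_concat a b) = Poly_Mapping.lookup p b"
proof -
  let ?B = "{b \<in> Poly_Mapping.keys p. composable Q a b}"
  have inj: "inj_on (path_concat a) ?B" by (auto simp: inj_on_def path_concat_left_cancel)
  have "path_concat a b \<in> path_concat a ` ?B \<longleftrightarrow> b \<in> ?B"
    using assms by (auto simp: path_concat_left_cancel)
  then show ?thesis unfolding pa_mult_single_left
    using assms inv_into_f_f[OF inj, of b] by (subst lookup_sum_single_inj[OF _ inj]) (auto simp: in_keys_iff)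
qed

lemma keys_mult_left:
  fixes p :: "('v, 'e) path \<Rightarrow>\<^sub>0 'k::field"
  assumes "t \<in> Poly_Mapping.keys (pa_mult Q (Poly_Mapping.single a 1) p)"
  obtains b where "b \<in> Poly_Mapping.keys p" "composable Q a b" "t = path_concat a b"
proof -
  let ?B = "{b \<in> Poly_Mapping.keys p. composable Q a b}"
  have inj: "inj_on (path_concat a) ?B" by (auto simp: inj_on_def path_concat_left_cancel)
  have "t \<in> path_concat a ` ?B"
    using assms unfolding pa_mult_single_left in_keys_iff[of t]
    by (subst (asm) lookup_sum_single_inj[OF _ inj]) (auto split: if_splits)
  then show ?thesis using that by auto
qed

lemma path_algebra_add: "p \<in> path_algebra Q \<Longrightarrow> q \<in> path_algebra Q \<Longrightarrow> p + q \<in> path_algebra Q"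
  using Poly_Mapping.keys_add[of p q] by (auto simp: path_algebra_def)

lemma path_algebra_zero: "0 \<in> path_algebra Q"
  by (simp add: path_algebra_def)

lemma path_algebra_sum: "(\<And>i. i \<in> I \<Longrightarrow> p i \<in> path_algebra Q) \<Longrightarrow> (\<Sum>i\<in>I. p i) \<in> path_algebra Q"
  by (induction I rule: infinite_finite_induct) (auto intro: path_algebra_add path_algebra_zero)

lemma path_algebra_single: "b \<in> paths Q \<Longrightarrow> Poly_Mapping.single b k \<in> path_algebra Q"
  by (simp add: path_algebra_def)

lemma (in wf_digraph) path_algebra_mult_right:
  "p \<in> path_algebra G \<Longrightarrow> c \<in> paths G \<Longrightarrow> pa_mult G p (Poly_Mapping.single c 1) \<in> path_algebra G"
  by (auto simp: path_algebra_def elim!: keys_mult_right intro!: path_concat_closed)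

lemma (in wf_digraph) path_algebra_mult_left:
  "p \<in> path_algebra G \<Longrightarrow> a \<in> paths G \<Longrightarrow> pa_mult G (Poly_Mapping.single a 1) p \<in> path_algebra G"
  by (auto simp: path_algebra_def elim!: keys_mult_left intro!: path_concat_closed)

lemma sum_singles_eq: "(\<Sum>b\<in>Poly_Mapping.keys p. Poly_Mapping.single b (Poly_Mapping.lookup p b)) = p"
  by (rule poly_mapping_eqI) (auto simp: lookup_sum lookup_single when_def in_keys_iff)

section \<open>The quotient algebra\<close>

locale basic_quotient =
  fixes S :: "('v, 'e, 'k::field, 'a::{ring, monoid_mult}) sig_data"
  assumes fin: "fin_digraph (quiver S)"
    and quotient: "quotient_algebra S"
    and basic: "basic_algebra S"
    and ordP: "monomial_ordering S"
begin

abbreviation Q :: "('v, 'e) pre_digraph" where "Q \<equiv> quiver S"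

sublocale fin_digraph Q by (rule fin)

sublocale A: vector_space "scaleA S"
  using quotient by (simp add: quotient_algebra_def)

lemma psi_add: "p \<in> path_algebra Q \<Longrightarrow> q \<in> path_algebra Q \<Longrightarrow> psi S (p + q) = psi S p + psi S q"
  using quotient by (simp add: quotient_algebra_def)

lemma psi_mult: "p \<in> path_algebra Q \<Longrightarrow> q \<in> path_algebra Q \<Longrightarrow> psi S (pa_mult Q p q) = psi S p * psi S q"
  using quotient by (simp add: quotient_algebra_def)

lemma psi_scale: "p \<in> path_algebra Q \<Longrightarrow> psi S (pa_scale k p) = scaleA S k (psi S p)"
  using quotient by (simp add: quotient_algebra_def)

lemma psi_zero: "psi S 0 = 0"
  using psi_add[OF path_algebra_zero path_algebra_zero] by simp

lemma psi_sum: "(\<And>i. i \<in> I \<Longrightarrow> p i \<in> path_algebra Q) \<Longrightarrow> psi S (\<Sum>i\<in>I. p i) = (\<Sum>i\<in>I. psi S (p i))"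
  by (induction I rule: infinite_finite_induct) (auto simp: psi_zero psi_add path_algebra_sum)

lemma psi_single: "b \<in> paths Q \<Longrightarrow> psi S (Poly_Mapping.single b k) = scaleA S k (psi_mon S b)"
  using psi_scale[of "Poly_Mapping.single b 1" k]
  by (simp add: psi_mon_def pa_scale_single path_algebra_single)

lemma psi_expand:
  assumes "p \<in> path_algebra Q"
  shows "psi S p = (\<Sum>b\<in>Poly_Mapping.keys p. scaleA S (Poly_Mapping.lookup p b) (psi_mon S b))"
proof -
  have keys: "b \<in> paths Q" if "b \<in> Poly_Mapping.keys p" for b
    using that assms by (auto simp: path_algebra_def)
  have "psi S p = psi S (\<Sum>b\<in>Poly_Mapping.keys p. Poly_Mapping.single b (Poly_Mapping.lookup p b))"
    using sum_singles_eq[of p] by simp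
  also have "\<dots> = (\<Sum>b\<in>Poly_Mapping.keys p. psi S (Poly_Mapping.single b (Poly_Mapping.lookup p b)))"
    using keys by (intro psi_sum path_algebra_single)
  also have "\<dots> = (\<Sum>b\<in>Poly_Mapping.keys p. scaleA S (Poly_Mapping.lookup p b) (psi_mon S b))"
    using keys by (intro sum.cong) (simp_all add: psi_single)
  finally show ?thesis .
qed

lemma psi_surj: obtains p where "p \<in> path_algebra Q" "psi S p = x"
proof -
  have "x \<in> psi S ` path_algebra Q" using quotient by (simp add: quotient_algebra_def)
  then show ?thesis using that by auto
qed

lemma psi_mon_mult:
  "b \<in> paths Q \<Longrightarrow> c \<in> paths Q \<Longrightarrow>
    psi_mon S b * psi_mon S c = (if composable Q b c then psi_mon S (path_concat b c) else 0)"
  using psi_mult[of "Poly_Mapping.single b 1" "Poly_Mapping.single c 1"]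
  by (simp add: psi_mon_def path_algebra_single pa_mult_single_single psi_zero split: if_splits)

lemma sum_trivial_paths: "(\<Sum>v\<in>verts Q. psi_mon S (v, [])) = 1"
proof -
  have "psi S (pa_one Q) = 1" using quotient by (simp add: quotient_algebra_def)
  then show ?thesis
    unfolding pa_one_def psi_mon_def by (subst (asm) psi_sum) (auto intro: path_algebra_single trivial_path)
qed

text \<open>
  The quotient map transports the bilinearity of the multiplication from monomials.
\<close>

lemma scaleA_mult: "scaleA S \<alpha> x * scaleA S \<beta> y = scaleA S (\<alpha> * \<beta>) (x * y)"
proof -
  have mon: "scaleA S \<gamma> (psi_mon S b) * scaleA S \<delta> (psi_mon S c) = scaleA S (\<gamma> * \<delta>) (psi_mon S b * psi_mon S c)"
    if "b \<in> paths Q" "c \<in> paths Q" for b c \<gamma> \<delta>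
    using psi_mult[of "Poly_Mapping.single b \<gamma>" "Poly_Mapping.single c \<delta>"] that
    by (cases "composable Q b c") (simp_all add: path_algebra_single pa_mult_single_single psi_zero
        psi_single psi_mon_mult path_concat_closed)
  obtain p q where p: "p \<in> path_algebra Q" "psi S p = x" and q: "q \<in> path_algebra Q" "psi S q = y"
    using psi_surj by metis
  let ?P = "Poly_Mapping.keys p" and ?Q = "Poly_Mapping.keys q"
  have P: "b \<in> paths Q" if "b \<in> ?P" for b using p that by (auto simp: path_algebra_def)
  have Q: "b \<in> paths Q" if "b \<in> ?Q" for b using q that by (auto simp: path_algebra_def)
  have prod: "scaleA S \<alpha> x * scaleA S \<beta> y = (\<Sum>b\<in>?P. \<Sum>c\<in>?Q.
      scaleA S ((\<alpha> * Poly_Mapping.lookup p b) * (\<beta> * Poly_Mapping.lookup q c)) (psi_mon S b * psi_mon S c))" for \<alpha> \<beta>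
    unfolding p(2)[symmetric] q(2)[symmetric] psi_expand[OF p(1)] psi_expand[OF q(1)]
      A.scale_sum_right A.scale_scale sum_product
    using P Q by (intro sum.cong) (simp_all add: mon)
  have "scaleA S (\<alpha> * \<beta>) (x * y) = scaleA S (\<alpha> * \<beta>) (scaleA S 1 x * scaleA S 1 y)" by simp
  also have "\<dots> = scaleA S \<alpha> x * scaleA S \<beta> y"
    unfolding prod by (simp add: A.scale_sum_right ac_simps)
  finally show ?thesis by simp
qed

sublocale RA: right_vector_action "(*)" "scaleA S" "\<lambda>k. scaleA S k 1"
proof unfold_locales
  fix k x a
  show "scaleA S k x = x * scaleA S k 1" using scaleA_mult[of 1 x k 1] by simp
  show "scaleA S k x * a = scaleA S k (x * a)" using scaleA_mult[of k x 1 a] by simp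
qed (simp_all add: algebra_simps)

lemma arrow_in_radical: "e \<in> arcs Q \<Longrightarrow> psi_mon S (tail Q e, [e]) \<in> Rad (*) (UNIV :: 'a set)"
  using basic by (auto simp: basic_algebra_def ideal_generated_def)

subsection \<open>Nilpotency\<close>

text \<open>
  This is the \<open>k\<close>-th power of the ideal generated by the arrows, hence of the radical of the algebra.
\<close>

definition path_ideal :: "nat \<Rightarrow> 'a set" where
  "path_ideal k = A.span (psi_mon S ` {b \<in> paths Q. k \<le> path_deg b})"

lemma psi_mon_in_path_ideal: "b \<in> paths Q \<Longrightarrow> k \<le> path_deg b \<Longrightarrow> psi_mon S b \<in> path_ideal k"
  by (auto simp: path_ideal_def intro: A.span_base)

lemma subspace_path_ideal: "A.subspace (path_ideal k)"
  by (simp add: path_ideal_def)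

lemma path_ideal_0: "path_ideal 0 = UNIV"
proof -
  have "x \<in> path_ideal 0" for x
  proof -
    obtain p where p: "p \<in> path_algebra Q" "psi S p = x" using psi_surj .
    then show ?thesis
      unfolding p(2)[symmetric] psi_expand[OF p(1)]
      by (intro A.subspace_sum[OF subspace_path_ideal] A.subspace_scale[OF subspace_path_ideal]
          psi_mon_in_path_ideal) (auto simp: path_algebra_def)
  qed
  then show ?thesis by auto
qed

lemma path_ideal_mult:
  assumes x: "x \<in> path_ideal k" and y: "y \<in> path_ideal l"
  shows "x * y \<in> path_ideal (k + l)"
proof -
  have mon: "x * psi_mon S c \<in> path_ideal (k + l)" if c: "c \<in> paths Q" "l \<le> path_deg c" for c
    using x unfolding path_ideal_def[of k]
  proof (induction rule: A.span_induct_alt)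
    case base
    then show ?case by (simp add: A.subspace_0[OF subspace_path_ideal])
  next
    case (step \<alpha> z y)
    then obtain b where b: "z = psi_mon S b" "b \<in> paths Q" "k \<le> path_deg b" by auto
    have "psi_mon S b * psi_mon S c \<in> path_ideal (k + l)"
      using b c psi_mon_in_path_ideal[of "path_concat b c" "k + l"] A.subspace_0[OF subspace_path_ideal[of "k + l"]]
      by (auto simp: psi_mon_mult path_concat_closed path_deg_concat)
    then show ?case using step b
      by (simp add: distrib_right RA.ract_scl A.subspace_add[OF subspace_path_ideal]
          A.subspace_scale[OF subspace_path_ideal])
  qed
  show ?thesis
    using y unfolding path_ideal_def[of l]
  proof (induction rule: A.span_induct_alt)
    case base
    then show ?case by (simp add: A.subspace_0[OF subspace_path_ideal])
  next
    case (step \<alpha> z y)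
    then have "x * z \<in> path_ideal (k + l)" using mon by auto
    then show ?case using step scaleA_mult[of 1 x \<alpha> z]
      by (simp add: distrib_left A.subspace_add[OF subspace_path_ideal]
          A.subspace_scale[OF subspace_path_ideal])
  qed
qed

lemma path_ideal_right_submodule: "right_submodule (*) (path_ideal k) UNIV"
  using path_ideal_mult[of _ k _ 0]
  by (intro right_submoduleI)
    (auto simp: path_ideal_0 intro: A.subspace_0 A.subspace_add A.subspace_neg subspace_path_ideal)

text \<open>
  A path of length at least \<open>k + 1\<close> is a path of length at least \<open>k\<close> times an arrow, and the arrow
  lies in the radical.
\<close>

lemma path_ideal_Suc_subset_maximal:
  assumes "maximal_submodule (*) N (path_ideal k)"
  shows "path_ideal (Suc k) \<subseteq> N"
  unfolding path_ideal_def[of "Suc k"]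
proof (rule A.span_minimal)
  have N: "right_submodule (*) N (path_ideal k)" using assms by (simp add: maximal_submodule_def)
  then show "A.subspace N" by (rule RA.right_submodule_subspace)
  have M: "right_submodule (*) (path_ideal k) (path_ideal k)"
    using path_ideal_right_submodule[of k] by (simp add: right_submodule_def)
  show "psi_mon S ` {b \<in> paths Q. Suc k \<le> path_deg b} \<subseteq> N"
  proof clarify
    fix u p assume b: "(u, p) \<in> paths Q" "Suc k \<le> path_deg (u, p)"
    then obtain l where l: "path_deg (u, p) = Suc l" "k \<le> l" by (cases "path_deg (u, p)") auto
    obtain b' e where b': "b' \<in> paths Q" "e \<in> arcs Q" "composable Q b' (tail Q e, [e])"
      "(u, p) = path_concat b' (tail Q e, [e])" "path_deg b' = l"
      using path_last_arrowE[OF b(1) l(1)] by blast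
    have "psi_mon S (u, p) = psi_mon S b' * psi_mon S (tail Q e, [e])"
      using b' by (simp add: psi_mon_mult arrow_path)
    then show "psi_mon S (u, p) \<in> N"
      using RA.maximal_submodule_absorbs_radical[OF M assms psi_mon_in_path_ideal[OF b'(1)]
          arrow_in_radical[OF b'(2)]] b' l by simp
  qed
qed

text \<open>
  A proper submodule of largest dimension is maximal.
\<close>

lemma exists_maximal_submodule:
  assumes M: "right_submodule (*) M (UNIV :: 'a set)" "M \<noteq> {0}"
  obtains N where "maximal_submodule (*) N M"
proof -
  obtain B where "finite_dimensional_vector_space (scaleA S) B"
    using basic by (auto simp: basic_algebra_def)
  then interpret FD: finite_dimensional_vector_space "scaleA S" B .
  let ?P = "\<lambda>N. right_submodule (*) N M \<and> N \<noteq> M"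
  have "right_submodule (*) {0} M" using right_submoduleD(2)[OF M(1)] by (simp add: right_submodule_def)
  then have "?P {0}" using M(2) by auto
  moreover have "\<forall>N. ?P N \<longrightarrow> A.dim N < Suc FD.dimension"
    by (simp add: FD.dim_subset_UNIV less_Suc_eq_le)
  ultimately have "\<exists>N. ?P N \<and> (\<forall>N'. ?P N' \<longrightarrow> A.dim N' \<le> A.dim N)"
    by (rule ex_has_greatest_nat[where P = ?P])
  then obtain N where N: "?P N" and max: "\<forall>N'. ?P N' \<longrightarrow> A.dim N' \<le> A.dim N"
    by metis
  have "maximal_submodule (*) N M"
    unfolding maximal_submodule_def
  proof (intro conjI allI impI)
    fix N' assume N': "right_submodule (*) N' M \<and> N \<subseteq> N'"
    show "N' = N \<or> N' = M"
    proof (rule ccontr)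
      assume "\<not> ?thesis"
      then have "N \<subset> N'" "N' \<noteq> M" using N' by auto
      moreover have "A.span N = N" "A.span N' = N'"
        using N N' by (auto simp: A.span_eq_iff intro: RA.right_submodule_subspace)
      ultimately have "A.dim N < A.dim N'" by (intro FD.dim_psubset) (simp only:)
      then show False using max[rule_format, of N'] N' \<open>N' \<noteq> M\<close> by simp
    qed
  qed (use N in auto)
  then show ?thesis using that by blast
qed

text \<open>
  As in Nakayama's lemma, every non-zero \<open>path_ideal k\<close> strictly contains the next one: it has a
  maximal submodule, which contains \<open>path_ideal (Suc k)\<close>.  The dimensions cannot decrease forever.
\<close>

lemma path_ideal_nilpotent: obtains n where "path_ideal n = {0}"
proof (rule ccontr)
  assume "\<not> thesis"
  then have ne: "path_ideal k \<noteq> {0}" for k using that by blast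
  obtain B where "finite_dimensional_vector_space (scaleA S) B"
    using basic by (auto simp: basic_algebra_def)
  then interpret FD: finite_dimensional_vector_space "scaleA S" B .
  have less: "A.dim (path_ideal (Suc k)) < A.dim (path_ideal k)" for k
  proof -
    obtain N where N: "maximal_submodule (*) N (path_ideal k)"
      using exists_maximal_submodule[OF path_ideal_right_submodule ne] .
    then have "N \<subset> path_ideal k" by (auto simp: maximal_submodule_def right_submodule_def)
    then have "path_ideal (Suc k) \<subset> path_ideal k" using path_ideal_Suc_subset_maximal[OF N] by blast
    moreover have "A.span (path_ideal j) = path_ideal j" for j
      using subspace_path_ideal by (simp add: A.span_eq_iff)
    ultimately show ?thesis by (intro FD.dim_psubset) (simp only:)
  qed
  have "A.dim (path_ideal k) + k \<le> A.dim (path_ideal 0)" for k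
  proof (induction k)
    case (Suc k)
    then show ?case using less[of k] by linarith
  qed simp
  from this[of "Suc (A.dim (path_ideal 0))"] show False by simp
qed

section \<open>Standard monomials\<close>

lemma total_ltP: "total_ordering_on (paths Q) (ltP S)"
  using ordP by (simp add: monomial_ordering_def monP_def)

lemma ltP_mult_left:
  assumes "b1 \<in> paths Q" "b2 \<in> paths Q" "b \<in> paths Q" "ltP S b2 b1" "composable Q b b1" "composable Q b b2"
  shows "ltP S (path_concat b b2) (path_concat b b1)"
  using ordP assms by (simp add: monomial_ordering_def monP_def)

lemma lmP_greatest:
  assumes "p \<in> path_algebra Q" "p \<noteq> 0"
  shows "is_greatest (ltP S) (Poly_Mapping.keys p) (lmP S p)"
  unfolding lmP_def using assms
  by (intro is_greatest_greatest[OF total_ltP]) (auto simp: path_algebra_def)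

lemma lmP_eqI:
  assumes "p \<in> path_algebra Q" "is_greatest (ltP S) (Poly_Mapping.keys p) b"
  shows "lmP S p = b"
  unfolding lmP_def using assms by (intro greatest_eqI[OF total_ltP]) (auto simp: path_algebra_def)

lemma stdMon_iff:
  "b \<in> stdMon S \<longleftrightarrow> b \<in> paths Q \<and> (\<forall>p. p \<in> path_algebra Q \<and> psi S p = 0 \<and> p \<noteq> 0 \<longrightarrow> lmP S p \<noteq> b)"
  by (auto simp: stdMon_def ker_psi_def monP_def)

text \<open>
  Leading monomials of the kernel are closed under multiplication by paths: if \<open>b\<close> is the leading
  monomial of \<open>p\<close>, then \<open>a b\<close> is the leading monomial of \<open>a p\<close>.  So suffixes of standard monomials are standard.
\<close>

lemma stdMon_suffix:
  assumes "path_concat a b \<in> stdMon S" "composable Q a b" "a \<in> paths Q" "b \<in> paths Q"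
  shows "b \<in> stdMon S"
proof (rule ccontr)
  assume "b \<notin> stdMon S"
  then obtain p where p: "p \<in> path_algebra Q" "psi S p = 0" "p \<noteq> 0" "lmP S p = b"
    using assms by (auto simp: stdMon_iff)
  let ?q = "pa_mult Q (Poly_Mapping.single a 1) p"
  have gr: "is_greatest (ltP S) (Poly_Mapping.keys p) b" using lmP_greatest[OF p(1,3)] p(4) by simp
  have q: "?q \<in> path_algebra Q" using p assms by (intro path_algebra_mult_left)
  have "psi S ?q = 0" using psi_mult[OF path_algebra_single[OF assms(3)] p(1)] p by simp
  moreover have key: "path_concat a b \<in> Poly_Mapping.keys ?q"
    using gr lookup_mult_left[OF assms(2), of p] by (simp add: in_keys_iff is_greatest_def)
  then have "?q \<noteq> 0" by auto
  moreover have "is_greatest (ltP S) (Poly_Mapping.keys ?q) (path_concat a b)"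
    unfolding is_greatest_def
  proof (intro conjI ballI key)
    fix t assume "t \<in> Poly_Mapping.keys ?q"
    then obtain b' where b': "b' \<in> Poly_Mapping.keys p" "composable Q a b'" "t = path_concat a b'"
      by (rule keys_mult_left)
    then have "b' = b \<or> ltP S b' b" "b' \<in> paths Q" using gr p by (auto simp: is_greatest_def path_algebra_def)
    then show "t = path_concat a b \<or> ltP S t (path_concat a b)"
      using b' assms ltP_mult_left[of b b' a] by auto
  qed
  then have "lmP S ?q = path_concat a b" by (rule lmP_eqI[OF q])
  ultimately show False using assms(1) q by (auto simp: stdMon_iff)
qed

text \<open>
  A relation between standard monomials is an element of the kernel; if it were not trivial, its
  leading monomial would be standard.
\<close>

lemma psi_stdMon_independent:
  assumes T: "finite T" "T \<subseteq> stdMon S" and sum: "(\<Sum>b\<in>T. scaleA S (u b) (psi_mon S b)) = 0"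
    and b: "b \<in> T"
  shows "u b = 0"
proof (rule ccontr)
  assume "u b \<noteq> 0"
  have T': "b \<in> paths Q" if "b \<in> T" for b using that T by (auto simp: stdMon_iff)
  define p where "p = (\<Sum>b\<in>T. Poly_Mapping.single b (u b))"
  have p: "p \<in> path_algebra Q" unfolding p_def using T' by (intro path_algebra_sum path_algebra_single)
  have "psi S p = (\<Sum>b\<in>T. psi S (Poly_Mapping.single b (u b)))"
    unfolding p_def using T' by (intro psi_sum path_algebra_single)
  also have "\<dots> = 0" using T' unfolding sum[symmetric] by (intro sum.cong) (auto simp: psi_single)
  finally have psi: "psi S p = 0" .
  have lookup: "Poly_Mapping.lookup p c = (if c \<in> T then u c else 0)" for c
    using T(1) by (simp add: p_def lookup_sum lookup_single when_def)
  then have "p \<noteq> 0" using \<open>u b \<noteq> 0\<close> b by (metis lookup_zero)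
  then have "lmP S p \<in> T" using lmP_greatest[OF p] lookup by (auto simp: is_greatest_def in_keys_iff split: if_splits)
  then have "lmP S p \<in> stdMon S" using T(2) by blast
  then show False using p psi \<open>p \<noteq> 0\<close> unfolding stdMon_iff by blast
qed

lemma psi_mon_inj: "inj_on (psi_mon S) (stdMon S)"
proof (rule inj_onI, rule ccontr)
  fix b c assume bc: "b \<in> stdMon S" "c \<in> stdMon S" "psi_mon S b = psi_mon S c" "b \<noteq> c"
  have "(\<Sum>x\<in>{b, c}. scaleA S (if x = b then 1 else -1) (psi_mon S x)) = 0" using bc by simp
  then have "(if b = b then 1 else -1 :: 'k) = 0"
    using bc by (intro psi_stdMon_independent[where T = "{b, c}" and b = b]) auto
  then show False by simp
qed

lemma lam_psi_mon: "b \<in> stdMon S \<Longrightarrow> lam S (psi_mon S b) = b"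
  unfolding lam_def using psi_mon_inj by (intro the_equality) (auto simp: inj_on_def)

lemma lam_monA: "x \<in> monA S \<Longrightarrow> lam S x \<in> stdMon S" "x \<in> monA S \<Longrightarrow> psi_mon S (lam S x) = x"
  by (auto simp: monA_def lam_psi_mon)

lemma lam_path: "x \<in> monA S \<Longrightarrow> lam S x \<in> paths Q"
  using lam_monA(1) stdMon_iff by blast

lemma psi_mon_monA: "b \<in> stdMon S \<Longrightarrow> psi_mon S b \<in> monA S"
  by (simp add: monA_def)

lemma long_paths_vanish: "\<exists>n. \<forall>b\<in>paths Q. n \<le> path_deg b \<longrightarrow> psi_mon S b = 0"
proof -
  obtain n where "path_ideal n = {0}" by (rule path_ideal_nilpotent)
  then show ?thesis using psi_mon_in_path_ideal[of _ n] by (intro exI[of _ n]) blast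
qed

text \<open>
  A path that is zero in the algebra is the leading monomial of an element of the kernel, namely of
  itself.  By nilpotency this applies to all long paths.
\<close>

lemma finite_stdMon: "finite (stdMon S)"
proof -
  obtain n where n: "\<And>b. b \<in> paths Q \<Longrightarrow> n \<le> path_deg b \<Longrightarrow> psi_mon S b = 0"
    using long_paths_vanish by blast
  have "stdMon S \<subseteq> {b \<in> paths Q. path_deg b \<le> n}"
  proof
    fix b assume b: "b \<in> stdMon S"
    then have bp: "b \<in> paths Q" by (simp add: stdMon_iff)
    have "path_deg b \<le> n"
    proof (rule ccontr)
      assume "\<not> path_deg b \<le> n"
      then have "psi S (Poly_Mapping.single b 1) = 0" using n[OF bp] by (simp add: psi_mon_def)
      moreover have "lmP S (Poly_Mapping.single b 1) = b"
        using bp by (intro lmP_eqI path_algebra_single) (auto simp: is_greatest_def)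
      moreover have "Poly_Mapping.single b (1::'k) \<noteq> 0" by (metis keys_single insert_not_empty keys_zero zero_neq_one)
      ultimately show False using b bp path_algebra_single[OF bp, of 1] unfolding stdMon_iff by blast
    qed
    then show "b \<in> {b \<in> paths Q. path_deg b \<le> n}" using bp by simp
  qed
  then show ?thesis using finite_paths_of_bounded_degree finite_subset by blast
qed

lemma finite_monA: "finite (monA S)"
  by (simp add: monA_def finite_stdMon)

lemma independent_monA: "A.independent (monA S)"
  unfolding A.independent_explicit_finite_subsets
proof (intro allI impI ballI)
  fix T u x assume T: "T \<subseteq> monA S" "finite T" and sum: "(\<Sum>v\<in>T. scaleA S (u v) v) = 0" and x: "x \<in> T"
  have inj: "inj_on (lam S) T" using T lam_monA(2) by (intro inj_on_inverseI[of T "psi_mon S"]) auto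
  have "(\<Sum>b\<in>lam S ` T. scaleA S (u (psi_mon S b)) (psi_mon S b)) = (\<Sum>v\<in>T. scaleA S (u v) v)"
    unfolding sum.reindex[OF inj] o_def using T lam_monA(2) by (intro sum.cong) auto
  then have "u (psi_mon S (lam S x)) = 0"
    using sum T x lam_monA(1) by (intro psi_stdMon_independent[where T = "lam S ` T"]) auto
  then show "u x = 0" using T x lam_monA(2) by auto
qed

text \<open>
  A path that is not standard equals, modulo the kernel, a combination of smaller paths.  The
  ordering need not be a well-ordering, but the paths that are too long vanish, and among the
  finitely many others the replacement of a path by smaller ones ends.
\<close>

lemma span_monA: "A.span (monA S) = UNIV"
proof -
  obtain n where n: "\<And>b. b \<in> paths Q \<Longrightarrow> n \<le> path_deg b \<Longrightarrow> psi_mon S b = 0"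
    using long_paths_vanish by blast
  let ?X = "{b \<in> paths Q. path_deg b \<le> n}"
  have mon: "psi_mon S b \<in> A.span (monA S)" if "b \<in> paths Q" for b
    using that
  proof (induction "card {c \<in> ?X. ltP S c b}" arbitrary: b rule: less_induct)
    case less
    consider "path_deg b > n" | "b \<in> stdMon S" | "path_deg b \<le> n" "b \<notin> stdMon S" by linarith
    then show ?case
    proof cases
      case 1
      then show ?thesis using n[OF less.prems] by (simp add: A.span_zero)
    next
      case 2
      then show ?thesis by (intro A.span_base psi_mon_monA)
    next
      case 3
      then obtain p where p: "p \<in> path_algebra Q" "psi S p = 0" "p \<noteq> 0" "lmP S p = b"
        using less.prems by (auto simp: stdMon_iff)
      let ?K = "Poly_Mapping.keys p" and ?l = "Poly_Mapping.lookup p"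
      have gr: "is_greatest (ltP S) ?K b" using lmP_greatest[OF p(1,3)] p(4) by simp
      then have bK: "b \<in> ?K" by (simp add: is_greatest_def)
      have rest: "psi_mon S c \<in> A.span (monA S)" if c: "c \<in> ?K - {b}" for c
      proof -
        have cp: "c \<in> paths Q" using c p by (auto simp: path_algebra_def)
        have cb: "ltP S c b" using c gr by (auto simp: is_greatest_def)
        show ?thesis
        proof (cases "path_deg c \<le> n")
          case True
          have "{d \<in> ?X. ltP S d c} \<subset> {d \<in> ?X. ltP S d b}"
            using cb cp True less.prems total_ordering_on_trans[OF total_ltP _ cb]
              total_ordering_on_irrefl[OF total_ltP cp] by blast
          then have "card {d \<in> ?X. ltP S d c} < card {d \<in> ?X. ltP S d b}"
            by (intro psubset_card_mono finite_subset[OF _ finite_paths_of_bounded_degree[of n]]) auto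
          then show ?thesis using less.hyps cp by blast
        next
          case False
          then show ?thesis using n[OF cp] by (simp add: A.span_zero)
        qed
      qed
      have "scaleA S (?l b) (psi_mon S b) + (\<Sum>c\<in>?K - {b}. scaleA S (?l c) (psi_mon S c)) = 0"
        using p(2) bK unfolding psi_expand[OF p(1)] by (simp add: sum.remove[of ?K b])
      then have "scaleA S (?l b) (psi_mon S b) = - (\<Sum>c\<in>?K - {b}. scaleA S (?l c) (psi_mon S c))"
        by (simp add: eq_neg_iff_add_eq_0)
      also have "\<dots> \<in> A.span (monA S)"
        using rest by (intro A.span_neg A.span_sum A.span_scale)
      finally have "scaleA S (inverse (?l b)) (scaleA S (?l b) (psi_mon S b)) \<in> A.span (monA S)"
        by (rule A.span_scale)
      then show ?thesis using bK by (simp add: in_keys_iff)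
    qed
  qed
  have "x \<in> A.span (monA S)" for x
  proof -
    obtain p where p: "p \<in> path_algebra Q" "psi S p = x" using psi_surj .
    show ?thesis
      unfolding p(2)[symmetric] psi_expand[OF p(1)]
      using p(1) by (intro A.span_sum A.span_scale mon) (auto simp: path_algebra_def)
  qed
  then show ?thesis by auto
qed

lemma coeffA_add: "coeffA S (x + y) b = coeffA S x b + coeffA S y b"
  using A.representation_add[OF independent_monA] by (simp add: coeffA_def span_monA)

lemma coeffA_scale: "coeffA S (scaleA S k x) b = k * coeffA S x b"
  using A.representation_scale[OF independent_monA] by (simp add: coeffA_def span_monA)

lemma coeffA_monA: "b \<in> monA S \<Longrightarrow> coeffA S b c = (if c = b then 1 else 0)"
  using A.representation_basis[OF independent_monA] by (simp add: coeffA_def)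

lemma coeffA_zero: "coeffA S 0 b = 0"
  using coeffA_scale[of 0 0] by simp

lemma coeffA_sum: "coeffA S (sum f I) b = (\<Sum>i\<in>I. coeffA S (f i) b)"
  by (induction I rule: infinite_finite_induct) (auto simp: coeffA_zero coeffA_add)

lemma monA_expand: "(\<Sum>b\<in>monA S. scaleA S (coeffA S x b) b) = x"
  unfolding coeffA_def by (rule A.sum_representation_eq[OF independent_monA _ finite_monA]) (auto simp: span_monA)

lemma coeffA_nonzero: "x \<noteq> 0 \<Longrightarrow> \<exists>b\<in>monA S. coeffA S x b \<noteq> 0"
proof (rule ccontr)
  assume "x \<noteq> 0" "\<not> (\<exists>b\<in>monA S. coeffA S x b \<noteq> 0)"
  then have "(\<Sum>b\<in>monA S. scaleA S (coeffA S x b) b) = 0" by (intro sum.neutral) auto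
  then show False using \<open>x \<noteq> 0\<close> by (simp add: monA_expand)
qed

lemma total_ltA: "total_ordering_on (monA S) (ltA S)"
  unfolding total_ordering_on_def ltA_def
proof (intro conjI)
  show "irreflp_on (monA S) (\<lambda>x y. ltP S (lam S x) (lam S y))"
    by (rule irreflp_onI) (blast dest: total_ordering_on_irrefl[OF total_ltP lam_path])
  show "transp_on (monA S) (\<lambda>x y. ltP S (lam S x) (lam S y))"
    by (rule transp_onI) (blast intro: total_ordering_on_trans[OF total_ltP] lam_path)
  show "totalp_on (monA S) (\<lambda>x y. ltP S (lam S x) (lam S y))"
  proof (rule totalp_onI)
    fix x y assume xy: "x \<in> monA S" "y \<in> monA S" "x \<noteq> y"
    then have "lam S x \<noteq> lam S y" using lam_monA(2) by metis
    then show "ltP S (lam S x) (lam S y) \<or> ltP S (lam S y) (lam S x)"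
      using total_ordering_on_total[OF total_ltP lam_path lam_path] xy by blast
  qed
qed

lemma lmA_greatest:
  assumes "x \<noteq> 0" shows "is_greatest (ltA S) {b \<in> monA S. coeffA S x b \<noteq> 0} (lmA S x)"
  unfolding lmA_def using coeffA_nonzero[OF assms] finite_monA
  by (intro is_greatest_greatest[OF total_ltA]) auto

text \<open>
  A small cofactor multiplies like a path: no reduction to standard monomials takes place.
\<close>

lemma small_cofactor_mult:
  assumes "small_cofactor S b c"
  shows "b * c \<in> monA S" "lam S (b * c) = path_concat (lam S b) (lam S c)"
proof -
  note bc = assms[unfolded small_cofactor_def]
  have "b * c = psi_mon S (path_concat (lam S b) (lam S c))"
    using bc psi_mon_mult[of "lam S b" "lam S c"] by (simp add: lam_monA lam_path)
  then show "b * c \<in> monA S" "lam S (b * c) = path_concat (lam S b) (lam S c)"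
    using bc by (simp_all add: lam_psi_mon psi_mon_monA)
qed

end

section \<open>The free module over the quotient algebra\<close>

locale signature_setting = basic_quotient S
  for S :: "('v, 'e, 'k::field, 'a::{ring, monoid_mult}) sig_data" +
  assumes ordF: "compatible_ordering_F S"
    and generates: "generates_M S"
    and ordE: "compatible_ordering_E S"
    and negdeg: "negative_degree_ordering S"
begin

sublocale RF: right_vector_action act "scaleF S" "\<lambda>k. scaleA S k 1"
proof unfold_locales
  fix k x a
  show "scaleF S k x = act x (scaleA S k 1)"
    using scaleA_mult[of 1 _ k 1] by (simp add: act_def scaleF_def)
  show "act (scaleF S k x) a = scaleF S k (act x a)"
    by (simp add: act_def scaleF_def RA.ract_scl)
qed (auto simp: act_def scaleF_def algebra_simps A.scale_right_distrib A.scale_left_distrib)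

definition coefF :: "(nat \<Rightarrow> 'a) \<Rightarrow> nat \<times> 'a \<Rightarrow> 'k" where
  "coefF f t = coeffA S (f (fst t)) (snd t)"

lemma lmF_leading: "lmF S f = leading (ltF S) (monF S) coefF f"
  unfolding lmF_def leading_def coefF_def by (rule arg_cong[of _ _ "greatest (ltF S)"]) auto

lemma total_ltF: "total_ordering_on (monF S) (ltF S)"
  using ordF by (simp add: compatible_ordering_F_def)

lemma finite_monF: "finite (monF S)"
  by (simp add: monF_def finite_monA)

lemma coefF_add: "coefF (f + g) t = coefF f t + coefF g t"
  by (simp add: coefF_def coeffA_add)

lemma coefF_scale: "coefF (scaleF S k f) t = k * coefF f t"
  by (simp add: coefF_def scaleF_def coeffA_scale)

lemma coefF_eq_0:
  assumes "f \<in> modF S" "\<And>t. t \<in> monF S \<Longrightarrow> coefF f t = 0"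
  shows "f = 0"
proof (rule ccontr)
  assume "f \<noteq> 0"
  then obtain i where i: "f i \<noteq> 0" by (auto simp: fun_eq_iff)
  then obtain b where "b \<in> monA S" "coeffA S (f i) b \<noteq> 0" using coeffA_nonzero by blast
  moreover have "i < rankF S" using i assms(1) by (metis (mono_tags, lifting) mem_Collect_eq modF_def not_le)
  ultimately show False using assms(2)[of "(i, b)"] by (simp add: monF_def coefF_def)
qed

lemma lmF_greatest:
  assumes "f \<in> modF S" "f \<noteq> 0"
  shows "is_greatest (ltF S) {t \<in> monF S. coefF f t \<noteq> 0} (lmF S f)"
  unfolding lmF_leading leading_def
  using assms coefF_eq_0[OF assms(1)] finite_monF by (intro is_greatest_greatest[OF total_ltF]) auto

lemma lmF_eqI: "is_greatest (ltF S) {t \<in> monF S. coefF f t \<noteq> 0} t \<Longrightarrow> lmF S f = t"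
  unfolding lmF_leading leading_def by (rule greatest_eqI[OF total_ltF]) auto

text \<open>
  Small cofactors preserve leading monomials.  The product of the leading monomial with \<open>c\<close> is again
  a monomial, and by compatibility all other products, although they may expand into many
  monomials, stay below it.
\<close>

lemma lmF_act:
  assumes f: "f \<in> modF S" "f \<noteq> 0" and c: "small_cofactor_F S (lmF S f) c"
  shows "act f c \<noteq> 0" "lmF S (act f c) = mult_monF (lmF S f) c"
proof -
  obtain i b where lm: "lmF S f = (i, b)" by (cases "lmF S f")
  have gr: "is_greatest (ltF S) {t \<in> monF S. coefF f t \<noteq> 0} (i, b)" using lmF_greatest[OF f] lm by simp
  then have ib: "i < rankF S" "b \<in> monA S" "coeffA S (f i) b \<noteq> 0"
    by (auto simp: is_greatest_def monF_def coefF_def)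
  have sc: "small_cofactor S b c" using c lm by (simp add: small_cofactor_F_def)
  note bc = small_cofactor_mult[OF sc]
  have coef: "coefF (act f c) (j, t) = (\<Sum>b\<in>monA S. coeffA S (f j) b * coeffA S (b * c) t)" for j t
  proof -
    have "act f c j = (\<Sum>b\<in>monA S. scaleA S (coeffA S (f j) b) b) * c" by (simp add: act_def monA_expand)
    also have "\<dots> = (\<Sum>b\<in>monA S. scaleA S (coeffA S (f j) b) (b * c))"
      by (simp add: sum_distrib_right RA.ract_scl)
    finally show ?thesis by (simp add: coefF_def coeffA_sum coeffA_scale)
  qed
  have less: "ltF S (j, t) (i, b * c)"
    if j: "j < rankF S" "b2 \<in> monA S" "coeffA S (f j) b2 \<noteq> 0" "(j, b2) \<noteq> (i, b)"
      and t: "t \<in> monA S" "coeffA S (b2 * c) t \<noteq> 0" for j b2 t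
  proof -
    have "b2 * c \<noteq> 0" using t by (auto simp: coeffA_zero)
    moreover have "ltF S (j, b2) (i, b)"
      using gr j unfolding is_greatest_def by (auto simp: monF_def coefF_def)
    ultimately have 1: "ltF S (j, lmA S (b2 * c)) (i, b * c)"
      using ordF ib j sc unfolding compatible_ordering_F_def by blast
    have lmA: "lmA S (b2 * c) \<in> monA S" "t = lmA S (b2 * c) \<or> ltA S t (lmA S (b2 * c))"
      using lmA_greatest[OF \<open>b2 * c \<noteq> 0\<close>] t by (auto simp: is_greatest_def)
    then have "t = lmA S (b2 * c) \<or> ltF S (j, t) (j, lmA S (b2 * c))"
      using ordF j t unfolding compatible_ordering_F_def by blast
    then show ?thesis
      using 1 total_ordering_on_trans[OF total_ltF _ 1, of "(j, t)"] lmA(1) t(1) j(1) ib(1) bc(1)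
      by (auto simp: monF_def)
  qed
  have "(\<Sum>b'\<in>monA S - {b}. coeffA S (f i) b' * coeffA S (b' * c) (b * c)) = 0"
  proof (rule sum.neutral, rule ballI, rule ccontr)
    fix b' assume "b' \<in> monA S - {b}" "coeffA S (f i) b' * coeffA S (b' * c) (b * c) \<noteq> 0"
    then have "ltF S (i, b * c) (i, b * c)" using less[of i b' "b * c"] ib bc by auto
    then show False using total_ordering_on_irrefl[OF total_ltF, of "(i, b * c)"] ib bc by (simp add: monF_def)
  qed
  then have "coefF (act f c) (i, b * c) = coeffA S (f i) b * coeffA S (b * c) (b * c)"
    unfolding coef using ib finite_monA by (subst sum.remove[of _ b]) auto
  then have nz: "coefF (act f c) (i, b * c) \<noteq> 0" using ib bc by (simp add: coeffA_monA)
  then show "act f c \<noteq> 0" by (auto simp: coefF_def coeffA_zero)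
  have "is_greatest (ltF S) {t \<in> monF S. coefF (act f c) t \<noteq> 0} (i, b * c)"
    unfolding is_greatest_def
  proof (intro conjI ballI)
    show "(i, b * c) \<in> {t \<in> monF S. coefF (act f c) t \<noteq> 0}" using nz ib bc by (simp add: monF_def)
    fix s assume s: "s \<in> {t \<in> monF S. coefF (act f c) t \<noteq> 0}"
    obtain j t where jt: "s = (j, t)" by (cases s)
    have "(\<Sum>b\<in>monA S. coeffA S (f j) b * coeffA S (b * c) t) \<noteq> 0"
      using s jt by (simp add: coef)
    then obtain b2 where b2: "b2 \<in> monA S" "coeffA S (f j) b2 * coeffA S (b2 * c) t \<noteq> 0"
      by (rule sum.not_neutral_contains_not_neutral)
    show "s = (i, b * c) \<or> ltF S s (i, b * c)"
    proof (cases "(j, b2) = (i, b)")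
      case True
      then have "t = b * c" using b2 bc by (auto simp: coeffA_monA split: if_splits)
      then show ?thesis using jt True by simp
    next
      case False
      then show ?thesis using less[of j b2 t] b2 s jt by (auto simp: monF_def)
    qed
  qed
  then show "lmF S (act f c) = mult_monF (lmF S f) c" by (simp add: lmF_eqI lm mult_monF_def)
qed

section \<open>The degree filtration\<close>

text \<open>
  The submodule \<open>M J\<^sup>k\<close>, where \<open>J\<close> is the radical of the algebra.
\<close>

definition Mdeg :: "nat \<Rightarrow> (nat \<Rightarrow> 'a) set" where
  "Mdeg k = RF.span {act (gens S ! i) (psi_mon S b) | i b. i < length (gens S) \<and> b \<in> paths Q \<and> k \<le> path_deg b}"

lemma subspace_Mdeg: "RF.subspace (Mdeg k)"
  by (simp add: Mdeg_def)

lemma Mdeg_generator: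
  "i < length (gens S) \<Longrightarrow> b \<in> paths Q \<Longrightarrow> k \<le> path_deg b \<Longrightarrow> act (gens S ! i) (psi_mon S b) \<in> Mdeg k"
  unfolding Mdeg_def by (intro RF.span_base) blast

lemma act_gen_path_ideal:
  assumes i: "i < length (gens S)" and a: "a \<in> path_ideal k"
  shows "act (gens S ! i) a \<in> Mdeg k"
  using a unfolding path_ideal_def
proof (induction rule: A.span_induct_alt)
  case base
  show ?case by (simp only: RF.ract_zero_right RF.subspace_0[OF subspace_Mdeg])
next
  case (step \<alpha> z y)
  then have "act (gens S ! i) z \<in> Mdeg k" using i Mdeg_generator by auto
  moreover have "act (gens S ! i) (scaleA S \<alpha> z) = scaleF S \<alpha> (act (gens S ! i) z)"
    using scaleA_mult[of 1 _ \<alpha> z] by (simp add: act_def scaleF_def)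
  ultimately show ?case using step(2)
    by (simp only: RF.ract_add_right RF.subspace_add[OF subspace_Mdeg] RF.subspace_scale[OF subspace_Mdeg])
qed

lemma Mdeg_act:
  assumes x: "x \<in> Mdeg k" and a: "a \<in> path_ideal l"
  shows "act x a \<in> Mdeg (k + l)"
  using x unfolding Mdeg_def[of k]
proof (induction rule: RF.span_induct_alt)
  case base
  show ?case by (simp only: RF.ract_zero_left RF.subspace_0[OF subspace_Mdeg])
next
  case (step \<alpha> z y)
  then obtain i b where ib: "z = act (gens S ! i) (psi_mon S b)" "i < length (gens S)" "b \<in> paths Q" "k \<le> path_deg b"
    by auto
  then have "act z a = act (gens S ! i) (psi_mon S b * a)" by (simp add: RF.ract_assoc)
  then have "act z a \<in> Mdeg (k + l)"
    using act_gen_path_ideal[OF ib(2) path_ideal_mult[OF psi_mon_in_path_ideal[OF ib(3,4)] a]] by simp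
  then show ?case using step(2)
    by (simp only: RF.ract_add_left RF.ract_scl RF.subspace_add[OF subspace_Mdeg] RF.subspace_scale[OF subspace_Mdeg])
qed

lemma Mdeg_right_submodule: "right_submodule act (Mdeg k) (Mdeg k)"
  using Mdeg_act[of _ k _ 0]
  by (intro right_submoduleI)
    (auto simp: path_ideal_0 intro: RF.subspace_0 RF.subspace_add RF.subspace_neg subspace_Mdeg)

lemma Mdeg_antimono: "k \<le> l \<Longrightarrow> Mdeg l \<subseteq> Mdeg k"
  unfolding Mdeg_def by (intro RF.span_mono) (blast intro: order_trans)

lemma Mdeg_0: "Mdeg 0 = modM S"
proof
  have M: "right_submodule act (modM S) (modF S)"
    "modM S = \<Inter> {N. right_submodule act N (modF S) \<and> set (gens S) \<subseteq> N}"
    using generates unfolding generates_M_def by blast+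
  have gens: "set (gens S) \<subseteq> modM S" by (subst M(2)) blast
  show sub: "Mdeg 0 \<subseteq> modM S"
    unfolding Mdeg_def
  proof (rule RF.span_minimal[OF _ RF.right_submodule_subspace[OF M(1)]], clarify)
    fix i u p assume "i < length (gens S)"
    then have "gens S ! i \<in> modM S" using gens by auto
    then show "act (gens S ! i) (psi_mon S (u, p)) \<in> modM S" by (rule right_submoduleD(5)[OF M(1)])
  qed
  have "right_submodule act (Mdeg 0) (modF S)"
    using Mdeg_right_submodule[of 0] sub right_submoduleD(1)[OF M(1)] by (auto simp: right_submodule_def)
  moreover have "set (gens S) \<subseteq> Mdeg 0"
  proof
    fix g assume "g \<in> set (gens S)"
    then obtain i where "i < length (gens S)" "g = gens S ! i" by (auto simp: in_set_conv_nth)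
    then show "g \<in> Mdeg 0" using act_gen_path_ideal[of i 1 0] by (simp add: path_ideal_0 RF.ract_one)
  qed
  ultimately show "modM S \<subseteq> Mdeg 0" by (subst M(2)) blast
qed

lemma Mdeg_subset_modM: "Mdeg k \<subseteq> modM S"
  using Mdeg_antimono[of 0 k] Mdeg_0 by simp

lemma modM_subset_modF: "modM S \<subseteq> modF S"
  using generates unfolding generates_M_def right_submodule_def by blast

lemma Mdeg_vanishes: "\<exists>n. Mdeg n = {0}"
proof -
  obtain n where n: "\<forall>b\<in>paths Q. n \<le> path_deg b \<longrightarrow> psi_mon S b = 0"
    using long_paths_vanish by blast
  have "Mdeg n \<subseteq> {0}"
    unfolding Mdeg_def by (rule RF.span_minimal) (auto simp: n RF.ract_zero_right)
  then show ?thesis using RF.subspace_0[OF subspace_Mdeg] by blast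
qed

text \<open>
  Trivial paths are eigenvectors modulo the arrows: a path of positive length lies in \<open>path_ideal 1\<close>,
  and the product of two trivial paths is one of them or zero.
\<close>

lemma trivial_path_eigenvector:
  assumes v: "v \<in> verts Q"
  shows "\<exists>\<kappa>. psi_mon S (v, []) * a - scaleA S \<kappa> (psi_mon S (v, [])) \<in> path_ideal 1"
proof -
  let ?e = "psi_mon S (v, [])"
  have "a \<in> path_ideal 0" by (simp add: path_ideal_0)
  then show ?thesis
    unfolding path_ideal_def[of 0]
  proof (induction rule: A.span_induct_alt)
    case base
    show ?case by (rule exI[of _ 0]) (simp add: A.subspace_0[OF subspace_path_ideal])
  next
    case (step \<alpha> z y)
    then obtain \<kappa> where \<kappa>: "?e * y - scaleA S \<kappa> ?e \<in> path_ideal 1" by blast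
    obtain b where b: "z = psi_mon S b" "b \<in> paths Q" using step by auto
    \<comment> \<open>The eigenvalue of the path \<open>b\<close> on \<open>?e\<close>.\<close>
    define \<delta> :: 'k where "\<delta> = (if b = (v, []) then 1 else 0)"
    have "?e * z - scaleA S \<delta> ?e \<in> path_ideal 1"
    proof (cases "path_deg b = 0")
      case True
      then obtain w where w: "b = (w, [])" using path_deg_0[OF b(2)] by blast
      have "?e * z = (if w = v then ?e else 0)"
        using b w psi_mon_mult[OF trivial_path[OF v] b(2)]
        by (auto simp: composable_def path_end_def path_concat_def)
      then show ?thesis by (simp add: \<delta>_def w A.subspace_0[OF subspace_path_ideal])
    next
      case False
      then have "\<delta> = 0" by (auto simp: \<delta>_def path_deg_def)
      moreover have "z \<in> path_ideal 1" using False b by (simp add: psi_mon_in_path_ideal)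
      then have "?e * z \<in> path_ideal 1" using path_ideal_mult[of ?e 0 z 1] by (simp add: path_ideal_0)
      ultimately show ?thesis by simp
    qed
    then have "scaleA S \<alpha> (?e * z - scaleA S \<delta> ?e) + (?e * y - scaleA S \<kappa> ?e) \<in> path_ideal 1"
      using \<kappa> by (intro A.subspace_add A.subspace_scale subspace_path_ideal)
    moreover have "?e * scaleA S \<alpha> z = scaleA S \<alpha> (?e * z)" using scaleA_mult[of 1 ?e \<alpha> z] by simp
    ultimately have "?e * (scaleA S \<alpha> z + y) - scaleA S (\<alpha> * \<delta> + \<kappa>) ?e \<in> path_ideal 1"
      by (simp add: distrib_left A.scale_right_diff_distrib A.scale_left_distrib algebra_simps)
    then show ?case by blast
  qed
qed

text \<open>
  One inclusion holds because maximal submodules absorb the radical of the algebra, to which the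
  arrows belong.  For the other one, the quotient of consecutive members of the filtration is killed
  by the arrows, so that it is spanned by common eigenvectors of the algebra, obtained by
  multiplication with the trivial paths.
\<close>

lemma Rad_Mdeg: "Rad act (Mdeg k) = Mdeg (Suc k)"
proof
  have N: "right_submodule act (Mdeg (Suc k)) (Mdeg k)"
    using Mdeg_right_submodule[of "Suc k"] Mdeg_antimono[of k "Suc k"] by (auto simp: right_submodule_def)
  show "Rad act (Mdeg k) \<subseteq> Mdeg (Suc k)"
  proof (rule RF.Rad_subset_if_semisimple_quotient[OF Mdeg_right_submodule N sum_trivial_paths])
    fix x v a assume x: "x \<in> Mdeg k" and v: "v \<in> verts Q"
    let ?e = "psi_mon S (v, [])"
    obtain \<kappa> where "?e * a - scaleA S \<kappa> ?e \<in> path_ideal 1" using trivial_path_eigenvector[OF v] by blast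
    then have "act x (?e * a - scaleA S \<kappa> ?e) \<in> Mdeg (Suc k)" using Mdeg_act[OF x, of _ 1] by simp
    moreover have "act x (?e * a - scaleA S \<kappa> ?e) = act (act x ?e) a - scaleF S \<kappa> (act x ?e)"
      using scaleA_mult[of 1 _ \<kappa> ?e] by (simp add: act_def scaleF_def fun_eq_iff right_diff_distrib mult.assoc)
    ultimately show "\<exists>\<kappa>. act (act x ?e) a - scaleF S \<kappa> (act x ?e) \<in> Mdeg (Suc k)" by auto
  qed
  show "Mdeg (Suc k) \<subseteq> Rad act (Mdeg k)"
    unfolding Rad_def
  proof (intro Int_greatest Inter_greatest, goal_cases)
    case 1
    then show ?case by (rule Mdeg_antimono) simp
  next
    case (2 N)
    then have max: "maximal_submodule act N (Mdeg k)" by simp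
    then have N: "right_submodule act N (Mdeg k)" by (simp add: maximal_submodule_def)
    show ?case
      unfolding Mdeg_def[of "Suc k"]
    proof (rule RF.span_minimal[OF _ RF.right_submodule_subspace[OF N]], clarify)
      fix i u p assume i: "i < length (gens S)" and b: "(u, p) \<in> paths Q" "Suc k \<le> path_deg (u, p)"
      then obtain l where l: "path_deg (u, p) = Suc l" "k \<le> l" by (cases "path_deg (u, p)") auto
      obtain b' e where b': "b' \<in> paths Q" "e \<in> arcs Q" "composable Q b' (tail Q e, [e])"
        "(u, p) = path_concat b' (tail Q e, [e])" "path_deg b' = l"
        using path_last_arrowE[OF b(1) l(1)] by blast
      have "act (gens S ! i) (psi_mon S (u, p)) = act (act (gens S ! i) (psi_mon S b')) (psi_mon S (tail Q e, [e]))"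
        using b' by (simp add: RF.ract_assoc psi_mon_mult arrow_path)
      then show "act (gens S ! i) (psi_mon S (u, p)) \<in> N"
        using RF.maximal_submodule_absorbs_radical[OF Mdeg_right_submodule max
            Mdeg_generator[OF i b'(1)] arrow_in_radical[OF b'(2)]] b' l by simp
    qed
  qed
qed

lemma Rad_power_modM: "(Rad act ^^ d) (modM S) = Mdeg d"
  by (induction d) (simp_all add: Mdeg_0 Rad_Mdeg)

section \<open>Signed elements\<close>

lemma ev_add:
  assumes "x \<in> modE S" "y \<in> modE S"
  shows "ev S (\<lambda>i. x i + y i) = ev S x + ev S y"
  using assms unfolding ev_def sum.distrib[symmetric]
  by (intro sum.cong) (auto simp: modE_def psi_add RF.ract_add_right)

lemma ev_single:
  assumes i: "i < length (gens S)" and b: "b \<in> paths Q"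
  shows "ev S (\<lambda>j. if j = i then Poly_Mapping.single b \<alpha> else 0) = scaleF S \<alpha> (act (gens S ! i) (psi_mon S b))"
proof -
  have "ev S (\<lambda>j. if j = i then Poly_Mapping.single b \<alpha> else 0)
      = (\<Sum>j<length (gens S). if j = i then act (gens S ! i) (psi S (Poly_Mapping.single b \<alpha>)) else 0)"
    unfolding ev_def by (intro sum.cong) (auto simp: psi_zero RF.ract_zero_right)
  also have "\<dots> = act (gens S ! i) (scaleA S \<alpha> (psi_mon S b))" using i b by (simp add: psi_single)
  also have "\<dots> = scaleF S \<alpha> (act (gens S ! i) (psi_mon S b))"
    using scaleA_mult[of 1 _ \<alpha> "psi_mon S b"] by (simp add: act_def scaleF_def)
  finally show ?thesis .
qed

text \<open>
  The filtration is the image of the filtration of \<open>E\<close> by path length.  This connects radicals with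
  signatures.
\<close>

lemma Mdeg_iff:
  "f \<in> Mdeg k \<longleftrightarrow>
    (\<exists>x\<in>modE S. (\<forall>i. \<forall>b\<in>Poly_Mapping.keys (x i). k \<le> path_deg b) \<and> ev S x = f)" (is "_ \<longleftrightarrow> ?R f")
proof
  assume "f \<in> Mdeg k"
  then show "?R f"
    unfolding Mdeg_def
  proof (induction rule: RF.span_induct_alt)
    case base
    show ?case
      by (rule bexI[of _ "\<lambda>_. 0"]) (auto simp: modE_def path_algebra_zero ev_def psi_zero RF.ract_zero_right)
  next
    case (step \<alpha> z f)
    then obtain x where x: "x \<in> modE S" "\<forall>i. \<forall>b\<in>Poly_Mapping.keys (x i). k \<le> path_deg b" "ev S x = f" by auto
    obtain i b where ib: "z = act (gens S ! i) (psi_mon S b)" "i < length (gens S)" "b \<in> paths Q" "k \<le> path_deg b"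
      using step by auto
    let ?y = "\<lambda>j. if j = i then Poly_Mapping.single b \<alpha> else 0"
    have y: "?y \<in> modE S" using ib by (auto simp: modE_def path_algebra_zero path_algebra_single)
    have "(\<lambda>j. ?y j + x j) \<in> modE S" using x y by (auto simp: modE_def path_algebra_add)
    moreover have "k \<le> path_deg c" if c: "c \<in> Poly_Mapping.keys (?y j + x j)" for j c
    proof -
      have "c \<in> Poly_Mapping.keys (?y j) \<or> c \<in> Poly_Mapping.keys (x j)"
        using c Poly_Mapping.keys_add[of "?y j" "x j"] by blast
      then show ?thesis using x(2) ib(4) by (auto split: if_splits)
    qed
    moreover have "ev S (\<lambda>j. ?y j + x j) = scaleF S \<alpha> z + f"
      using ev_add[OF y x(1)] ev_single[OF ib(2,3)] ib(1) x(3) by simp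
    ultimately show ?case by (intro bexI[of _ "\<lambda>j. ?y j + x j"]) auto
  qed
next
  assume "?R f"
  then obtain x where x: "x \<in> modE S" "\<forall>i. \<forall>b\<in>Poly_Mapping.keys (x i). k \<le> path_deg b" "ev S x = f" by blast
  show "f \<in> Mdeg k"
    unfolding x(3)[symmetric] ev_def
  proof (rule RF.subspace_sum[OF subspace_Mdeg], rule act_gen_path_ideal)
    fix i assume i: "i \<in> {..<length (gens S)}"
    then show "i < length (gens S)" by simp
    have xi: "x i \<in> path_algebra Q" using x(1) i by (simp add: modE_def)
    show "psi S (x i) \<in> path_ideal k"
      unfolding psi_expand[OF xi] using x(2) xi
      by (intro A.subspace_sum A.subspace_scale subspace_path_ideal psi_mon_in_path_ideal)
        (auto simp: path_algebra_def)
  qed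
qed

lemma total_ltE: "total_ordering_on (monE S) (ltE S)"
  using ordE by (simp add: compatible_ordering_E_def)

text \<open>
  A negative degree ordering refines the order by decreasing degree, so bounds on signatures turn
  into bounds on degrees.
\<close>

lemma leE_iff_deg:
  assumes t: "is_greatest (ltE S) {s \<in> monE S. degE s = k} t" and s: "s \<in> monE S"
  shows "leE S s t \<longleftrightarrow> k \<le> degE s"
proof
  have t': "t \<in> monE S" "degE t = k" using t by (auto simp: is_greatest_def)
  assume st: "leE S s t"
  show "k \<le> degE s"
  proof (rule ccontr)
    assume "\<not> k \<le> degE s"
    then have "ltE S t s" using negdeg s t' by (auto simp: negative_degree_ordering_def)
    then show False
      using st total_ordering_on_irrefl[OF total_ltE s] total_ordering_on_trans[OF total_ltE, of s t s] s t'
      by auto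
  qed
next
  have t': "t \<in> monE S" "degE t = k" using t by (auto simp: is_greatest_def)
  assume "k \<le> degE s"
  then consider "degE s = k" | "degE t < degE s" using t' by linarith
  then show "leE S s t"
  proof cases
    case 1
    then show ?thesis using t s unfolding is_greatest_def by blast
  next
    case 2
    then show ?thesis using negdeg s t' by (auto simp: negative_degree_ordering_def)
  qed
qed

definition suppE :: "(nat \<Rightarrow> (('v, 'e) path \<Rightarrow>\<^sub>0 'k)) \<Rightarrow> (nat \<times> ('v, 'e) path) set" where
  "suppE x = {(i, b). (i, b) \<in> monE S \<and> Poly_Mapping.lookup (x i) b \<noteq> 0}"

lemma lmE_suppE: "lmE S x = greatest (ltE S) (suppE x)"
  by (simp add: lmE_def suppE_def)

lemma suppE_subset: "suppE x \<subseteq> monE S"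
  by (auto simp: suppE_def)

lemma suppE_iff: "x \<in> modE S \<Longrightarrow> (i, b) \<in> suppE x \<longleftrightarrow> b \<in> Poly_Mapping.keys (x i)"
  by (cases "i < length (gens S)")
    (auto simp: suppE_def modE_def monE_def monP_def path_algebra_def lookup_not_eq_zero_eq_in_keys)

lemma lmE_greatest:
  assumes x: "x \<in> modE S" "x \<noteq> 0"
  shows "is_greatest (ltE S) (suppE x) (lmE S x)"
  unfolding lmE_suppE
proof (rule is_greatest_greatest[OF total_ltE suppE_subset])
  have "suppE x \<subseteq> Sigma {..<length (gens S)} (\<lambda>i. Poly_Mapping.keys (x i))"
    using suppE_iff[OF x(1)] by (auto simp: suppE_def monE_def)
  then show "finite (suppE x)" by (rule finite_subset) auto
  obtain i where "x i \<noteq> 0" using x(2) by (auto simp: fun_eq_iff)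
  then obtain b where "b \<in> Poly_Mapping.keys (x i)" using keys_eq_empty[of "x i"] by blast
  then show "suppE x \<noteq> {}" using suppE_iff[OF x(1)] by blast
qed

lemma lmE_eqI: "is_greatest (ltE S) (suppE x) s \<Longrightarrow> lmE S x = s"
  unfolding lmE_suppE by (rule greatest_eqI[OF total_ltE suppE_subset])

lemma signed_nonzero_modF: "g \<in> signed_nonzero S \<Longrightarrow> fst g \<in> modF S \<and> fst g \<noteq> 0"
  using modM_subset_modF by (auto simp: signed_nonzero_def signed_element_def)

text \<open>
  With a negative degree ordering the leading monomial has the smallest degree.
\<close>

lemma signed_nonzero_Mdeg:
  assumes "(f, s) \<in> signed_nonzero S"
  shows "f \<in> Mdeg (degE s)"
proof -
  obtain x where x: "x \<in> modE S" "x \<noteq> 0" "lmE S x = s" "ev S x = f" and s: "s \<in> monE S"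
    using assms by (auto simp: signed_nonzero_def signed_element_def)
  have gr: "is_greatest (ltE S) (suppE x) s" using lmE_greatest[OF x(1,2)] x(3) by simp
  have "degE s \<le> path_deg b" if b: "b \<in> Poly_Mapping.keys (x i)" for i b
  proof (rule ccontr)
    assume "\<not> degE s \<le> path_deg b"
    have ib: "(i, b) \<in> suppE x" using b suppE_iff[OF x(1)] by simp
    then have m: "(i, b) \<in> monE S" using suppE_subset by blast
    have "ltE S s (i, b)"
      using negdeg s m \<open>\<not> degE s \<le> path_deg b\<close> by (auto simp: negative_degree_ordering_def degE_def)
    moreover have "(i, b) = s \<or> ltE S (i, b) s" using gr ib by (auto simp: is_greatest_def)
    ultimately show False
      using total_ordering_on_irrefl[OF total_ltE s] total_ordering_on_trans[OF total_ltE, of s "(i, b)" s] s m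
      by auto
  qed
  then show ?thesis using x(1,4) unfolding Mdeg_iff by (intro bexI[of _ x]) auto
qed

lemma Mdeg_signed_nonzero:
  assumes f: "f \<in> Mdeg k" "f \<noteq> 0"
  obtains s where "(f, s) \<in> signed_nonzero S" "k \<le> degE s"
proof -
  obtain x where x: "x \<in> modE S" "\<forall>i. \<forall>b\<in>Poly_Mapping.keys (x i). k \<le> path_deg b" "ev S x = f"
    using f(1) unfolding Mdeg_iff by blast
  have "ev S 0 = 0"
    unfolding ev_def by (rule sum.neutral) (simp only: zero_fun_apply psi_zero RF.ract_zero_right, simp)
  then have "x \<noteq> 0" using f(2) x(3) by auto
  then have gr: "is_greatest (ltE S) (suppE x) (lmE S x)" by (rule lmE_greatest[OF x(1)])
  then have lm: "lmE S x \<in> suppE x" by (simp add: is_greatest_def)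
  obtain i b where ib: "lmE S x = (i, b)" by (cases "lmE S x")
  have "k \<le> degE (lmE S x)" using lm x(2) suppE_iff[OF x(1)] by (auto simp: ib degE_def)
  moreover have "f \<in> modM S" using f(1) Mdeg_subset_modM by blast
  then have "(f, lmE S x) \<in> signed_nonzero S"
    using f(2) x \<open>x \<noteq> 0\<close> lm suppE_subset by (auto simp: signed_nonzero_def signed_element_def)
  ultimately show ?thesis using that by blast
qed

text \<open>
  If \<open>x\<close> in \<open>E\<close> witnesses the signature of \<open>g\<close>, then \<open>x\<close> times the path \<open>\<lambda>(c)\<close> witnesses the
  signature of the product.
\<close>

lemma signed_nonzero_mult:
  assumes g: "g \<in> signed_nonzero S" and c: "small_cofactor_F S (lmF S (fst g)) c"
    and comp: "composableE S (snd g) (lam S c)"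
  shows "(act (fst g) c, concatE (snd g) (lam S c)) \<in> signed_nonzero S"
proof -
  obtain x where x: "x \<in> modE S" "x \<noteq> 0" "lmE S x = snd g" "ev S x = fst g" and s: "snd g \<in> monE S"
    and f: "fst g \<in> modM S" "fst g \<noteq> 0"
    using g by (auto simp: signed_nonzero_def signed_element_def)
  obtain i b where ib: "snd g = (i, b)" by (cases "snd g")
  define p where "p = lam S c"
  have cA: "c \<in> monA S" using c by (simp add: small_cofactor_F_def small_cofactor_def)
  have p: "p \<in> paths Q" "psi_mon S p = c" using cA by (simp_all add: p_def lam_path lam_monA)
  have comp': "composable Q b p" using comp ib by (simp add: composableE_def p_def)
  define y where "y j = pa_mult Q (x j) (Poly_Mapping.single p 1)" for j
  have y: "y \<in> modE S"
    using x(1) p(1) by (auto simp: modE_def y_def pa_mult_zero_left path_algebra_mult_right)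
  have "ev S y = act (ev S x) c"
  proof -
    have "ev S y = (\<Sum>j<length (gens S). act (act (gens S ! j) (psi S (x j))) c)"
      unfolding ev_def
    proof (rule sum.cong)
      fix j assume "j \<in> {..<length (gens S)}"
      then have "x j \<in> path_algebra Q" using x(1) by (simp add: modE_def)
      then have "psi S (y j) = psi S (x j) * c"
        using p psi_mult[of "x j" "Poly_Mapping.single p 1"] by (simp add: y_def path_algebra_single psi_single)
      then show "act (gens S ! j) (psi S (y j)) = act (act (gens S ! j) (psi S (x j))) c"
        by (simp add: RF.ract_assoc)
    qed simp
    also have "\<dots> = act (ev S x) c"
      unfolding ev_def by (rule RF.ract_sum_left[symmetric])
    finally show ?thesis .
  qed
  then have evy: "ev S y = act (fst g) c" using x(4) by simp
  have nz: "act (fst g) c \<noteq> 0"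
    using lmF_act(1)[OF _ _ c] f modM_subset_modF by blast
  have gr: "is_greatest (ltE S) (suppE x) (i, b)" using lmE_greatest[OF x(1,2)] x(3) ib by simp
  then have ibs: "(i, b) \<in> suppE x" by (simp add: is_greatest_def)
  have key: "(i, path_concat b p) \<in> suppE y"
    using ibs lookup_mult_right[OF comp', of "x i"]
    unfolding suppE_iff[OF x(1)] suppE_iff[OF y] by (simp add: y_def in_keys_iff)
  have "y \<noteq> 0" using evy nz key unfolding suppE_iff[OF y] by auto
  have "is_greatest (ltE S) (suppE y) (i, path_concat b p)"
    unfolding is_greatest_def
  proof (intro conjI ballI key)
    fix t assume t: "t \<in> suppE y"
    obtain j q where jq: "t = (j, q)" by (cases t)
    have "q \<in> Poly_Mapping.keys (pa_mult Q (x j) (Poly_Mapping.single p 1))"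
      using t suppE_iff[OF y] by (simp add: jq y_def)
    then obtain b' where b': "b' \<in> Poly_Mapping.keys (x j)" "composable Q b' p" "q = path_concat b' p"
      by (rule keys_mult_right)
    then have jb: "(j, b') \<in> suppE x" using suppE_iff[OF x(1)] by simp
    then have "(j, b') = (i, b) \<or> ltE S (j, b') (i, b)" using gr by (auto simp: is_greatest_def)
    then show "t = (i, path_concat b p) \<or> ltE S t (i, path_concat b p)"
    proof
      assume "(j, b') = (i, b)"
      then show ?thesis using b' jq by simp
    next
      assume lt: "ltE S (j, b') (i, b)"
      have "(j, b') \<in> monE S" "(i, b) \<in> monE S" using jb ibs suppE_subset by blast+
      then have "ltE S (concatE (j, b') p) (concatE (i, b) p)"
        using ordE lt b'(2) comp' p(1)
        unfolding compatible_ordering_E_def composableE_def monP_def by auto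
      then show ?thesis using jq b' by (simp add: concatE_def)
    qed
  qed
  then have "lmE S y = concatE (snd g) (lam S c)" by (simp add: lmE_eqI ib concatE_def p_def)
  moreover have "act (fst g) c \<in> modM S"
  proof -
    have "right_submodule act (modM S) (modF S)" using generates unfolding generates_M_def by blast
    from right_submoduleD(5)[OF this f(1)] show ?thesis .
  qed
  moreover have "concatE (snd g) (lam S c) \<in> monE S"
    using key suppE_subset by (auto simp: ib concatE_def p_def)
  ultimately show ?thesis
    using y \<open>y \<noteq> 0\<close> evy nz by (auto simp: signed_nonzero_def signed_element_def)
qed

section \<open>Bases from signed standard bases\<close>

lemma Bset_elementE:
  assumes G: "G \<subseteq> signed_nonzero S" and f: "f \<in> Bset S G t"
  obtains g c where "g \<in> G" "small_cofactor_F S (lmF S (fst g)) c" "composableE S (snd g) (lam S c)"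
    "leE S (concatE (snd g) (lam S c)) t" "s_irreducible S G (concatE (snd g) (lam S c)) f"
    "f = act (fst g) c" "(f, concatE (snd g) (lam S c)) \<in> signed_nonzero S"
    "f \<noteq> 0" "lmF S f = mult_monF (lmF S (fst g)) c"
proof -
  obtain g c where gc: "g \<in> G" "small_cofactor_F S (lmF S (fst g)) c" "composableE S (snd g) (lam S c)"
    "leE S (concatE (snd g) (lam S c)) t" "s_irreducible S G (concatE (snd g) (lam S c)) f"
    "f = act (fst g) c"
    using f unfolding Bset_def by blast
  have gn: "g \<in> signed_nonzero S" using G gc(1) by blast
  show ?thesis
    using that[OF gc] signed_nonzero_mult[OF gn gc(2,3)] lmF_act[OF _ _ gc(2)] signed_nonzero_modF[OF gn] gc(6)
    by simp
qed

text \<open>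
  Of two elements with the same leading monomial, the one with the larger signature would be
  reducible by the generator of the other one, so their signatures agree as well.  One of the two
  cofactors is then a suffix of the other one; what remains of the longer cofactor after the
  common suffix is removed exhibits one of the generators as a multiple of the other one, both in
  the leading monomial and in the signature.  In an interreduced set this happens only if the two
  generators coincide.
\<close>

lemma lmF_inj_on_Bset:
  assumes G: "G \<subseteq> signed_nonzero S" and inter: "interreduced S G"
  shows "inj_on (lmF S) (Bset S G t)"
proof (rule inj_onI)
  fix f f' assume "f \<in> Bset S G t" "f' \<in> Bset S G t" and lm: "lmF S f = lmF S f'"
  then obtain g c g' c'
    where g: "g \<in> G" "small_cofactor_F S (lmF S (fst g)) c" "composableE S (snd g) (lam S c)"
    "s_irreducible S G (concatE (snd g) (lam S c)) f"
    "f = act (fst g) c" "(f, concatE (snd g) (lam S c)) \<in> signed_nonzero S"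
    "f \<noteq> 0" "lmF S f = mult_monF (lmF S (fst g)) c"
    and g': "g' \<in> G" "small_cofactor_F S (lmF S (fst g')) c'" "composableE S (snd g') (lam S c')"
    "s_irreducible S G (concatE (snd g') (lam S c')) f'"
    "f' = act (fst g') c'" "(f', concatE (snd g') (lam S c')) \<in> signed_nonzero S"
    "f' \<noteq> 0" "lmF S f' = mult_monF (lmF S (fst g')) c'"
    using Bset_elementE[OF G] by metis
  let ?s = "concatE (snd g) (lam S c)" and ?s' = "concatE (snd g') (lam S c')"
  have "?s \<in> monE S" "?s' \<in> monE S"
    using g(6) g'(6) by (auto simp: signed_nonzero_def signed_element_def)
  moreover have "\<not> ltE S ?s' ?s"
    using g(4,7,8) g'(1,2,3,8) lm unfolding s_irreducible_def s_reducible_def by auto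
  moreover have "\<not> ltE S ?s ?s'"
    using g'(4,7,8) g(1,2,3,8) lm unfolding s_irreducible_def s_reducible_def by auto
  ultimately have sig: "?s = ?s'" using total_ordering_on_total[OF total_ltE] by blast
  have interD: "g = g'"
    if "g \<in> G" "g' \<in> G" "small_cofactor_F S (lmF S (fst g')) c" "mult_monF (lmF S (fst g')) c = lmF S (fst g)"
      "composableE S (snd g') (lam S c)" "concatE (snd g') (lam S c) = snd g" for g g' c
    using inter that unfolding interreduced_def by blast
  have lm': "mult_monF (lmF S (fst g)) c = mult_monF (lmF S (fst g')) c'" using lm g(8) g'(8) by simp
  have key: "g = g' \<and> c = c'"
    if g: "g \<in> G" "small_cofactor_F S (lmF S (fst g)) c" "composableE S (snd g) (lam S c)"
      and g': "g' \<in> G" "small_cofactor_F S (lmF S (fst g')) c'" "composableE S (snd g') (lam S c')"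
      and lm: "mult_monF (lmF S (fst g)) c = mult_monF (lmF S (fst g')) c'"
      and sig: "concatE (snd g) (lam S c) = concatE (snd g') (lam S c')"
      and len: "length (snd (lam S c')) \<le> length (snd (lam S c))" for g c g' c'
  proof -
    obtain i b where ib: "lmF S (fst g) = (i, b)" by (cases "lmF S (fst g)")
    obtain i' b' where ib': "lmF S (fst g') = (i', b')" by (cases "lmF S (fst g')")
    obtain j u q where s: "snd g = (j, (u, q))" by (metis prod.collapse)
    obtain j' u' q' where s': "snd g' = (j', (u', q'))" by (metis prod.collapse)
    have sc: "small_cofactor S b c" "small_cofactor S b' c'"
      using g(2) g'(2) ib ib' by (simp_all add: small_cofactor_F_def)
    note sc' = sc[unfolded small_cofactor_def]
    have eqs: "i = i'" "b * c = b' * c'" "j = j'" "u = u'" using lm sig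
      by (auto simp: mult_monF_def ib ib' concatE_def s s' path_concat_def)
    have cat: "path_concat (lam S b) (lam S c) = path_concat (lam S b') (lam S c')"
      using small_cofactor_mult(2)[OF sc(1)] small_cofactor_mult(2)[OF sc(2)] eqs by simp
    obtain v p where p: "lam S c = (v, p)" by (cases "lam S c")
    obtain v' p' where p': "lam S c' = (v', p')" by (cases "lam S c'")
    have qs: "q @ p = q' @ p'" using sig by (simp add: concatE_def s s' path_concat_def p p')
    \<comment> \<open>\<open>r\<close> is what remains of the longer cofactor when the common suffix \<open>p'\<close> is removed.\<close>
    define r where "r = take (length p - length p') p"
    have pr: "p = r @ p'"
    proof -
      have "drop (length (q @ p) - length p') (q @ p) = drop (length (q' @ p') - length p') (q' @ p')"
        using qs by simp
      then have "drop (length p - length p') p = p'" using len by (simp add: p p')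
      then show ?thesis unfolding r_def by (metis append_take_drop_id)
    qed
    have pc: "lam S c \<in> paths Q" "lam S c' \<in> paths Q" using sc' by (simp_all add: lam_path)
    obtain w where w: "(v, r) \<in> paths Q" "(w, p') \<in> paths Q" "composable Q (v, r) (w, p')"
      "path_end Q (w, p') = path_end Q (v, r @ p')"
      using path_splitE[of v r p'] pc(1) p pr by auto
    have vv: "path_concat (v, r) (w, p') = lam S c" by (simp add: path_concat_def p pr)
    have start: "composable Q (lam S b) (v, r)"
      using sc'(1) p by (simp add: composable_def)
    have bp: "lam S b \<in> paths Q" "lam S b' \<in> paths Q" "lam S b' \<in> stdMon S"
      using sc' by (simp_all add: lam_path lam_monA)
    have b': "lam S b' = path_concat (lam S b) (v, r)"
    proof -
      have "fst (lam S b') = fst (lam S b)" "snd (lam S b) @ r @ p' = snd (lam S b') @ p'"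
        using cat by (simp_all add: path_concat_def p p' pr)
      then show ?thesis by (simp add: path_concat_def prod_eq_iff)
    qed
    have std: "path_concat (lam S b) (v, r) \<in> stdMon S" using bp(3) b' by simp
    have vr: "(v, r) \<in> stdMon S" by (rule stdMon_suffix[OF std start bp(1) w(1)])
    define e where "e = psi_mon S (v, r)"
    have e: "e \<in> monA S" "lam S e = (v, r)" by (simp_all add: e_def psi_mon_monA vr lam_psi_mon)
    have sce: "small_cofactor S b e" using sc' e start std by (simp add: small_cofactor_def)
    have be: "b * e = b'"
    proof -
      have "lam S (b * e) = lam S b'" using small_cofactor_mult(2)[OF sce] e(2) b' by simp
      then show ?thesis using small_cofactor_mult(1)[OF sce] sc' lam_monA(2) by metis
    qed
    have 1: "small_cofactor_F S (lmF S (fst g)) e" using sce by (simp add: small_cofactor_F_def ib)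
    have 2: "mult_monF (lmF S (fst g)) e = lmF S (fst g')" using be eqs by (simp add: mult_monF_def ib ib')
    have 3: "composableE S (snd g) (lam S e)" using g(3) e(2) p by (simp add: composableE_def composable_def)
    have 4: "concatE (snd g) (lam S e) = snd g'"
      using qs eqs by (simp add: concatE_def s s' e(2) path_concat_def pr)
    have "g = g'" using interD[OF g'(1) g(1) 1 2 3 4] by simp
    then have "b = b'" using ib ib' by simp
    then have "r = []" using b' by (simp add: path_concat_def prod_eq_iff)
    moreover have "v = v'" using sc' p p' \<open>b = b'\<close> by (simp add: composable_def)
    ultimately have "lam S c = lam S c'" using p p' pr by simp
    then have "c = c'" using sc' lam_monA(2) by metis
    then show ?thesis using \<open>g = g'\<close> by simp
  qed
  show "f = f'"
  proof (cases "length (snd (lam S c')) \<le> length (snd (lam S c))")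
    case True
    then show ?thesis using key[OF g(1-3) g'(1-3) lm' sig] g(5) g'(5) by simp
  next
    case False
    then have "g' = g \<and> c' = c" by (intro key[OF g'(1-3) g(1-3) lm'[symmetric] sig[symmetric]]) simp
    then show ?thesis using g(5) g'(5) by simp
  qed
qed

text \<open>
  Among all signed elements with the leading monomial of \<open>f\<close>, one whose signature is minimal is
  irreducible with respect to \<open>M - {0}\<close>, since a reduction would give a signed element with the same
  leading monomial and a smaller signature.  The standard basis thus provides a generator \<open>g\<close> and a
  small cofactor \<open>c\<close> producing this leading monomial, and by minimality the signature of \<open>g c\<close> is
  the minimal one and \<open>g c\<close> is irreducible with respect to \<open>G\<close>.
\<close>

lemma leading_Bset:
  assumes G: "signed_standard_basis S G"
    and t: "is_greatest (ltE S) {s \<in> monE S. degE s = k} t"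
    and f: "f \<in> Mdeg k" "f \<noteq> 0"
  shows "\<exists>h\<in>Bset S G t. lmF S h = lmF S f"
proof -
  have Gs: "G \<subseteq> signed_nonzero S" using G by (simp add: signed_standard_basis_def)
  obtain n where n: "Mdeg n = {0}" using Mdeg_vanishes by blast
  define \<Sigma> where "\<Sigma> = {s. \<exists>h. (h, s) \<in> signed_nonzero S \<and> lmF S h = lmF S f}"
  have \<Sigma>E: "\<Sigma> \<subseteq> monE S" by (auto simp: \<Sigma>_def signed_nonzero_def signed_element_def)
  have "\<Sigma> \<subseteq> {..<length (gens S)} \<times> {b \<in> paths Q. path_deg b \<le> n}"
  proof
    fix s assume s: "s \<in> \<Sigma>"
    then obtain h where h: "(h, s) \<in> signed_nonzero S" by (auto simp: \<Sigma>_def)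
    have "degE s \<le> n"
    proof (rule ccontr)
      assume "\<not> degE s \<le> n"
      then have "h \<in> Mdeg n" using signed_nonzero_Mdeg[OF h] Mdeg_antimono[of n "degE s"] by auto
      then show False using h n by (simp add: signed_nonzero_def)
    qed
    then show "s \<in> {..<length (gens S)} \<times> {b \<in> paths Q. path_deg b \<le> n}"
      using s \<Sigma>E by (auto simp: monE_def monP_def degE_def)
  qed
  then have "finite \<Sigma>" by (rule finite_subset) (simp add: finite_paths_of_bounded_degree)
  obtain s0 where s0: "(f, s0) \<in> signed_nonzero S" "k \<le> degE s0" using Mdeg_signed_nonzero[OF f] .
  then have s0\<Sigma>: "s0 \<in> \<Sigma>" by (auto simp: \<Sigma>_def)
  \<comment> \<open>There are finitely many candidates although the ordering need not be a well-ordering: elements of large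
    degree evaluate to zero.\<close>
  define s where "s = greatest (\<lambda>x y. ltE S y x) \<Sigma>"
  have "is_greatest (\<lambda>x y. ltE S y x) \<Sigma> s"
    unfolding s_def using \<open>finite \<Sigma>\<close> s0\<Sigma>
    by (intro is_greatest_greatest[OF total_ordering_on_converse[OF total_ltE] \<Sigma>E]) auto
  then have s: "s \<in> \<Sigma>" and min: "\<And>s'. s' \<in> \<Sigma> \<Longrightarrow> s' = s \<or> ltE S s s'" by (auto simp: is_greatest_def)
  have sE: "s \<in> monE S" using s \<Sigma>E by blast
  have not_less: "\<not> ltE S s' s" if "s' \<in> \<Sigma>" for s'
    using min[OF that] that \<Sigma>E total_ordering_on_irrefl[OF total_ltE sE]
      total_ordering_on_trans[OF total_ltE, of s s' s] sE by auto
  have mult\<Sigma>: "concatE (snd g) (lam S c) \<in> \<Sigma>"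
    if "g \<in> signed_nonzero S" "small_cofactor_F S (lmF S (fst g)) c" "composableE S (snd g) (lam S c)"
      "mult_monF (lmF S (fst g)) c = lmF S f" for g c
    using signed_nonzero_mult[OF that(1-3)] lmF_act(2)[OF _ _ that(2)] signed_nonzero_modF[OF that(1)] that(4)
    unfolding \<Sigma>_def by auto
  obtain h where h: "(h, s) \<in> signed_nonzero S" "lmF S h = lmF S f" using s by (auto simp: \<Sigma>_def)
  have "s_irreducible S (signed_nonzero S) s h"
    using mult\<Sigma> not_less unfolding s_irreducible_def s_reducible_def h(2) by blast
  then have "weakly_s_reducible S G s h"
    using G h(1) unfolding signed_standard_basis_def by auto
  then obtain g c where gc: "g \<in> G" "small_cofactor_F S (lmF S (fst g)) c"
    "mult_monF (lmF S (fst g)) c = lmF S f" "composableE S (snd g) (lam S c)"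
    "leE S (concatE (snd g) (lam S c)) s"
    using h(2) unfolding weakly_s_reducible_def by auto
  have gn: "g \<in> signed_nonzero S" using gc(1) Gs by blast
  have gcs: "concatE (snd g) (lam S c) = s" using gc(5) mult\<Sigma>[OF gn gc(2,4,3)] not_less by blast
  have lm: "lmF S (act (fst g) c) = lmF S f"
    using lmF_act(2)[OF _ _ gc(2)] signed_nonzero_modF[OF gn] gc(3) by simp
  have irr: "s_irreducible S G (concatE (snd g) (lam S c)) (act (fst g) c)"
    using mult\<Sigma>[OF subsetD[OF Gs]] not_less gcs unfolding s_irreducible_def s_reducible_def lm by blast
  have "s0 \<in> monE S" using s0\<Sigma> \<Sigma>E by blast
  then have t0: "leE S s0 t" using leE_iff_deg[OF t] s0(2) by simp
  have tE: "t \<in> monE S" using t by (simp add: is_greatest_def)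
  have "leE S s t"
    using t0 min[OF s0\<Sigma>] total_ordering_on_trans[OF total_ltE, of s s0 t] sE \<open>s0 \<in> monE S\<close> tE by blast
  then have "act (fst g) c \<in> Bset S G t" using gc irr gcs unfolding Bset_def by blast
  then show ?thesis using lm by blast
qed

lemma Bset_basis:
  assumes G: "signed_standard_basis S G" "interreduced S G"
    and t: "is_greatest (ltE S) {s \<in> monE S. degE s = k} t"
  shows "RF.independent (Bset S G t)" "RF.span (Bset S G t) = Mdeg k"
proof -
  have Gs: "G \<subseteq> signed_nonzero S" using G by (simp add: signed_standard_basis_def)
  have sub: "Bset S G t \<subseteq> Mdeg k"
  proof
    fix f assume f: "f \<in> Bset S G t"
    show "f \<in> Mdeg k"
    proof (rule Bset_elementE[OF Gs f])
      fix g :: "('v, 'e, 'a) signed" and c :: 'a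
      let ?s = "concatE (snd g) (lam S c)"
      assume s: "leE S ?s t" "(f, ?s) \<in> signed_nonzero S"
      then have "?s \<in> monE S" by (simp add: signed_nonzero_def signed_element_def)
      then have "k \<le> degE ?s" using leE_iff_deg[OF t] s(1) by blast
      then show ?thesis using signed_nonzero_Mdeg[OF s(2)] Mdeg_antimono by blast
    qed
  qed
  have "0 \<notin> Bset S G t"
  proof
    assume "0 \<in> Bset S G t"
    then show False by (rule Bset_elementE[OF Gs]) simp
  qed
  note basis = RF.leading_monomials_basis[OF finite_monF total_ltF, of coefF, OF coefF_add coefF_scale
      subspace_Mdeg _ sub this]
  have 1: "f = 0" if "f \<in> Mdeg k" "\<And>x. x \<in> monF S \<Longrightarrow> coefF f x = 0" for f
    using that subsetD[OF Mdeg_subset_modM] subsetD[OF modM_subset_modF] by (intro coefF_eq_0) blast+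
  have 2: "inj_on (leading (ltF S) (monF S) coefF) (Bset S G t)"
    using lmF_inj_on_Bset[OF Gs G(2)] by (simp add: lmF_leading[abs_def])
  have 3: "\<exists>b\<in>Bset S G t. leading (ltF S) (monF S) coefF b = leading (ltF S) (monF S) coefF f"
    if "f \<in> Mdeg k" "f \<noteq> 0" for f
    using leading_Bset[OF G(1) t that] by (simp add: lmF_leading)
  show "RF.independent (Bset S G t)" by (rule basis(1)[OF 1 2 3])
  show "RF.span (Bset S G t) = Mdeg k" by (rule basis(2)[OF 1 2 3])
qed

end

theorem theorem4:
  fixes S :: "('v, 'e, 'k::field, 'a::{ring, monoid_mult}) sig_data"
    and G :: "('v, 'e, 'a) signed set"
    and d :: nat
    and \<tau> \<tau>' :: "nat \<times> ('v, 'e) path"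
  assumes "fin_digraph (quiver S)"
    and "quotient_algebra S"
    and "basic_algebra S"
    and "monomial_ordering S"
    and "compatible_ordering_F S"
    and "generates_M S"
    and "compatible_ordering_E S"
    and "negative_degree_ordering S"
    and "d > 0"
    and "is_greatest (ltE S) {s \<in> monE S. degE s = d - 1} \<tau>"
    and "is_greatest (ltE S) {s \<in> monE S. degE s = d} \<tau>'"
    and "signed_standard_basis S G"
    and "interreduced S G"
  shows "is_quotient_basis (scaleF S)
           ((Rad act ^^ (d - 1)) (modM S)) ((Rad act ^^ d) (modM S))
           ((\<lambda>f. f +o (Rad act ^^ d) (modM S)) ` (Bset S G \<tau> - Bset S G \<tau>'))"
proof -
  interpret signature_setting S
    using assms by (intro signature_setting.intro basic_quotient.intro signature_setting_axioms.intro)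
  have \<tau>: "\<tau> \<in> monE S" "degE \<tau> = d - 1" and \<tau>': "\<tau>' \<in> monE S" "degE \<tau>' = d"
    using assms by (auto simp: is_greatest_def)
  then have "ltE S \<tau>' \<tau>"
    using negdeg \<open>d > 0\<close> by (auto simp: negative_degree_ordering_def)
  have G: "G \<subseteq> signed_nonzero S" using assms by (simp add: signed_standard_basis_def)
  \<comment> \<open>A smaller bound on the signatures gives a smaller set, so the two bases are nested.\<close>
  have sub: "Bset S G \<tau>' \<subseteq> Bset S G \<tau>"
  proof
    fix f assume f: "f \<in> Bset S G \<tau>'"
    show "f \<in> Bset S G \<tau>"
    proof (rule Bset_elementE[OF G f])
      fix g :: "('v, 'e, 'a) signed" and c :: 'a
      let ?s = "concatE (snd g) (lam S c)"
      assume gc: "g \<in> G" "small_cofactor_F S (lmF S (fst g)) c" "composableE S (snd g) (lam S c)"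
        "leE S ?s \<tau>'" "s_irreducible S G ?s f" "f = act (fst g) c" "(f, ?s) \<in> signed_nonzero S"
      have "?s \<in> monE S" using gc(7) by (simp add: signed_nonzero_def signed_element_def)
      then have "leE S ?s \<tau>"
        using gc(4) \<open>ltE S \<tau>' \<tau>\<close> \<tau>(1) \<tau>'(1) total_ordering_on_trans[OF total_ltE] by blast
      then show ?thesis using gc(1-3,5,6) unfolding Bset_def by blast
    qed
  qed
  note basis = Bset_basis[OF \<open>signed_standard_basis S G\<close> \<open>interreduced S G\<close>]
  show ?thesis
    unfolding Rad_power_modM
    by (rule RF.nested_bases_quotient_basis[OF basis(1,2)[OF assms(10)] sub basis(2)[OF assms(11)]])
qed

end
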